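(* Let $A$ be a unital $C^*$-algebra, let $\mathcal{H}$ be a finitely or countably generated Hilbert $A$-module, and let $C\in GL(\mathcal{H})$ be self-adjoint. Then a family $\Psi=\{\psi_j\in\mathcal{H}: j\in J\}$ is a $C$-controlled frame for $\mathcal{H}$ if and only if $\Psi$ is a frame for $\mathcal{H}$ and $C$ is positive and commutes with the frame operator $S$ of $\Psi$.
   Context: Hilbert $A$-modules are left modules, with $A$-valued inner product $\langle\cdot,\cdot\rangle$ that is $A$-linear in the first variable, and norm $\|f\|=\|\langle f,f\rangle\|^{1/2}$. $J$ is a finite or countable index set. $GL(\mathcal{H})$ is the set of bounded linear operators on $\mathcal{H}$ with a bounded inverse. Given $C\in GL(\mathcal{H})$, a family $\{\psi_j\}_{j\in J}\subseteq\mathcal{H}$ is a $C$-controlled frame if there exist $m>0$ and $M<\infty$ such that $$m\langle f,f\rangle\le\sum_{j\in J}\langle f,\psi_j\rangle\langle C\psi_j,f\rangle\le M\langle f,f\rangle\quad\text{for all } f\in\mathcal{H},$$ where the sum converges in norm and the inequalities are in the order of $A$. In that case the operator $S_Cf=\sum_{j\in J}\langle f,\psi_j\rangle C\psi_j$ (which is well defined on $\mathcal{H}$) is called the $C$-controlled frame operator. A frame is a family $\{\psi_j\}$ for which there are constants $\alpha,\beta>0$ with $\alpha\langle f,f\rangle\le\sum_{j}\langle f,\psi_j\rangle\langle\psi_j,f\rangle\le\beta\langle f,f\rangle$ for all $f\in\mathcal{H}$; its frame operator is $Sf=\sum_{j\in J}\langle f,\psi_j\rangle\psi_j$. *)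

theory Defs
  imports "HOL-Analysis.Analysis"
begin

class complex_banach = banach +
  fixes scaleC :: "complex \<Rightarrow> 'a \<Rightarrow> 'a"  (infixr "*\<^sub>C" 75)
  assumes scaleC_add_right: "c *\<^sub>C (x + y) = c *\<^sub>C x + c *\<^sub>C y"
    and scaleC_add_left: "(c + d) *\<^sub>C x = c *\<^sub>C x + d *\<^sub>C x"
    and scaleC_scaleC: "c *\<^sub>C (d *\<^sub>C x) = (c * d) *\<^sub>C x"
    and scaleC_of_real: "complex_of_real r *\<^sub>C x = r *\<^sub>R x"
    and norm_scaleC: "norm (c *\<^sub>C x) = cmod c * norm x"

class unital_cstar_algebra = complex_banach + real_normed_algebra_1 +
  fixes involution :: "'a \<Rightarrow> 'a"
  assumes mult_scaleC_left: "(c *\<^sub>C a) * b = c *\<^sub>C (a * b)"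
    and mult_scaleC_right: "a * (c *\<^sub>C b) = c *\<^sub>C (a * b)"
    and involution_add: "involution (a + b) = involution a + involution b"
    and involution_scaleC: "involution (c *\<^sub>C a) = cnj c *\<^sub>C involution a"
    and involution_mult: "involution (a * b) = involution b * involution a"
    and involution_involution: "involution (involution a) = a"
    and cstar_identity: "norm (involution a * a) = (norm a)\<^sup>2"

definition spectrum :: "'a::unital_cstar_algebra \<Rightarrow> complex set" where
  "spectrum a = {c. \<not> (\<exists>b. (c *\<^sub>C 1 - a) * b = 1 \<and> b * (c *\<^sub>C 1 - a) = 1)}"

definition cstar_positive :: "'a::unital_cstar_algebra \<Rightarrow> bool" where
  "cstar_positive a \<longleftrightarrow> involution a = a \<and> spectrum a \<subseteq> nonneg_Reals"

definition cstar_le :: "'a::unital_cstar_algebra \<Rightarrow> 'a \<Rightarrow> bool"  (infix "\<preceq>" 50) where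
  "a \<preceq> b \<longleftrightarrow> cstar_positive (b - a)"

text \<open>Completeness of a Hilbert module is part of the class of the type \<open>'h\<close>; the axiom
  \<open>norm_eq\<close> says that the norm of that class is the one induced by the inner product.\<close>

locale hilbert_module =
  fixes act :: "'a::unital_cstar_algebra \<Rightarrow> 'h::complex_banach \<Rightarrow> 'h"
    and ip :: "'h \<Rightarrow> 'h \<Rightarrow> 'a"
  assumes act_add_left: "act (a + b) f = act a f + act b f"
    and act_add_right: "act a (f + g) = act a f + act a g"
    and act_mult: "act (a * b) f = act a (act b f)"
    and act_one: "act 1 f = f"
    and act_scaleC: "act (c *\<^sub>C a) f = c *\<^sub>C act a f"
    and ip_add_left: "ip (f + g) h = ip f h + ip g h"
    and ip_act_left: "ip (act a f) g = a * ip f g"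
    and ip_involution: "involution (ip f g) = ip g f"
    and ip_positive: "cstar_positive (ip f f)"
    and ip_definite: "ip f f = 0 \<Longrightarrow> f = 0"
    and norm_eq: "norm f = sqrt (norm (ip f f))"

definition module_hull :: "('a::unital_cstar_algebra \<Rightarrow> 'h::complex_banach \<Rightarrow> 'h) \<Rightarrow> 'h set \<Rightarrow> 'h set" where
  "module_hull act G = {\<Sum>g\<in>F. act (a g) g | F a. finite F \<and> F \<subseteq> G}"

definition finitely_generated :: "('a::unital_cstar_algebra \<Rightarrow> 'h::complex_banach \<Rightarrow> 'h) \<Rightarrow> bool" where
  "finitely_generated act \<longleftrightarrow> (\<exists>G. finite G \<and> module_hull act G = UNIV)"

definition countably_generated :: "('a::unital_cstar_algebra \<Rightarrow> 'h::complex_banach \<Rightarrow> 'h) \<Rightarrow> bool" where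
  "countably_generated act \<longleftrightarrow> (\<exists>G. countable G \<and> closure (module_hull act G) = UNIV)"

definition bounded_clinear :: "('h::complex_banach \<Rightarrow> 'h) \<Rightarrow> bool" where
  "bounded_clinear T \<longleftrightarrow> bounded_linear T \<and> (\<forall>c f. T (c *\<^sub>C f) = c *\<^sub>C T f)"

text \<open>Only complex linearity is required here; an operator that is self-adjoint for the
  module inner product is automatically linear over the algebra.\<close>

definition GL :: "('h::complex_banach \<Rightarrow> 'h) set" where
  "GL = {T. bounded_clinear T \<and> (\<exists>T'. bounded_clinear T' \<and> T \<circ> T' = id \<and> T' \<circ> T = id)}"

definition self_adjoint_op :: "('h \<Rightarrow> 'h \<Rightarrow> 'a) \<Rightarrow> ('h \<Rightarrow> 'h) \<Rightarrow> bool" where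
  "self_adjoint_op ip T \<longleftrightarrow> (\<forall>f g. ip (T f) g = ip f (T g))"

definition positive_op :: "('h \<Rightarrow> 'h \<Rightarrow> 'a::unital_cstar_algebra) \<Rightarrow> ('h \<Rightarrow> 'h) \<Rightarrow> bool" where
  "positive_op ip T \<longleftrightarrow> (\<forall>f. cstar_positive (ip (T f) f))"

text \<open>Sums over the index set are unordered norm-convergent sums, as \<open>J\<close> carries no enumeration.
  For the two families of inequalities below, norm convergence along some enumeration of \<open>J\<close>
  already implies unordered convergence: by polarization and surjectivity of the operator it yields
  norm convergence of the sums of the positive terms \<open>ip f (\<psi> j) * ip (\<psi> j) f\<close>.\<close>

definition controlled_frame ::
  "('h \<Rightarrow> 'h \<Rightarrow> 'a::unital_cstar_algebra) \<Rightarrow> ('h \<Rightarrow> 'h) \<Rightarrow> 'i set \<Rightarrow> ('i \<Rightarrow> 'h) \<Rightarrow> bool" where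
  "controlled_frame ip C J \<psi> \<longleftrightarrow>
    (\<exists>m M. m > 0 \<and>
      (\<forall>f. (\<lambda>j. ip f (\<psi> j) * ip (C (\<psi> j)) f) summable_on J \<and>
           m *\<^sub>R ip f f \<preceq> (\<Sum>\<^sub>\<infinity>j\<in>J. ip f (\<psi> j) * ip (C (\<psi> j)) f) \<and>
           (\<Sum>\<^sub>\<infinity>j\<in>J. ip f (\<psi> j) * ip (C (\<psi> j)) f) \<preceq> M *\<^sub>R ip f f))"

definition frame ::
  "('h \<Rightarrow> 'h \<Rightarrow> 'a::unital_cstar_algebra) \<Rightarrow> 'i set \<Rightarrow> ('i \<Rightarrow> 'h) \<Rightarrow> bool" where
  "frame ip J \<psi> \<longleftrightarrow>
    (\<exists>\<alpha> \<beta>. \<alpha> > 0 \<and> \<beta> > 0 \<and>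
      (\<forall>f. (\<lambda>j. ip f (\<psi> j) * ip (\<psi> j) f) summable_on J \<and>
           \<alpha> *\<^sub>R ip f f \<preceq> (\<Sum>\<^sub>\<infinity>j\<in>J. ip f (\<psi> j) * ip (\<psi> j) f) \<and>
           (\<Sum>\<^sub>\<infinity>j\<in>J. ip f (\<psi> j) * ip (\<psi> j) f) \<preceq> \<beta> *\<^sub>R ip f f))"

text \<open>If \<open>\<psi>\<close> is a frame, the defining sum converges in norm for every \<open>f\<close>, so the default value of
  \<open>infsum\<close> on divergent sums plays no role.\<close>

definition frame_operator ::
  "('a \<Rightarrow> 'h \<Rightarrow> 'h) \<Rightarrow> ('h \<Rightarrow> 'h \<Rightarrow> 'a::unital_cstar_algebra) \<Rightarrow>
    'i set \<Rightarrow> ('i \<Rightarrow> 'h::complex_banach) \<Rightarrow> 'h \<Rightarrow> 'h" where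
  "frame_operator act ip J \<psi> f = (\<Sum>\<^sub>\<infinity>j\<in>J. act (ip f (\<psi> j)) (\<psi> j))"

end

theory Submission
  imports Defs
begin

text \<open>All positivity arguments rest on one construction: if \<open>\<parallel>r\<parallel> < 1\<close>, then \<open>1 - r\<close> has a square root,
  found by a contraction, that inherits self-adjointness and the commutation relations of \<open>r\<close>. In the
  algebra this gives the order theory of the positive cone, and for operators on the module it shows
  that the product of commuting positive operators is positive.

  If \<open>\<psi>\<close> is a \<open>C\<close>-controlled frame, polarization bounds the form \<open>\<Sum> \<langle>f, \<psi>\<^sub>j\<rangle>\<langle>C \<psi>\<^sub>j, g\<rangle>\<close>, and \<open>g = C\<^sup>-\<^sup>1 f\<close>
  turns this into a Bessel bound, so the frame operator \<open>S\<close> exists. The form \<open>\<langle>C S f, f\<rangle>\<close> is then at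
  least \<open>m \<langle>f, f\<rangle>\<close> with \<open>m > 0\<close>; hence \<open>D = C S\<close> is self-adjoint, \<open>C\<close> and \<open>S\<close> commute, and \<open>S\<close> is
  surjective. Writing \<open>f = S g\<close> gives \<open>\<langle>C f, f\<rangle> = \<langle>D S g, g\<rangle> \<ge> 0\<close>, and for \<open>k\<close> at least the norm of
  \<open>C\<close>, positivity of \<open>(k - C) S\<close> gives the lower frame bound \<open>m / k\<close>. Conversely, for a frame with
  lower bound \<open>\<alpha>\<close> and \<open>k\<close> at least the norm of \<open>C\<^sup>-\<^sup>1\<close>, the products \<open>C (S - \<alpha>)\<close> and \<open>(k - C\<^sup>-\<^sup>1) C\<close>
  are positive, so \<open>C S \<ge> \<alpha> C \<ge> \<alpha> / k\<close>.\<close>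

section \<open>Square roots by a contraction\<close>

text \<open>The square root of \<open>1 - r\<close> is \<open>1 - y\<close>, where \<open>y\<close> is a fixed point of
  \<open>y \<mapsto> (r + y\<^sup>2) / 2\<close>; the closed set \<open>V\<close> transports properties of \<open>r\<close> to \<open>y\<close>.\<close>

lemma quadratic_fixpoint:
  fixes prod :: "'b::banach \<Rightarrow> 'b \<Rightarrow> 'b"
  assumes bil: "bounded_bilinear prod"
    and nrm: "\<And>x y. norm (prod x y) \<le> norm x * norm y"
    and r: "norm r < 1" and V: "closed V" "0 \<in> V"
    and step: "\<And>y. y \<in> V \<Longrightarrow> (1/2) *\<^sub>R (r + prod y y) \<in> V"
  obtains y where "y \<in> V" "y = (1/2) *\<^sub>R (r + prod y y)"
proof -
  interpret bounded_bilinear prod by (rule bil)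
  \<comment> \<open>The smaller root of \<open>\<rho>^2 - 2 * \<rho> + norm r = 0\<close>: the
    iteration maps the ball of radius \<open>\<rho>\<close> into itself and contracts there with
    constant \<open>\<rho> < 1\<close>.\<close>
  define \<rho> where "\<rho> = 1 - sqrt (1 - norm r)"
  have rho: "0 \<le> \<rho>" "\<rho> < 1" "norm r + \<rho>^2 = 2 * \<rho>"
    using r by (auto simp: \<rho>_def power2_eq_square algebra_simps)
  define S where "S = V \<inter> cball 0 \<rho>"
  define g where "g y = (1/2) *\<^sub>R (r + prod y y)" for y
  have "\<exists>!y. y \<in> S \<and> g y = y"
  proof (rule Banach_fix[where c = \<rho>])
    show "complete S" unfolding S_def by (simp add: complete_eq_closed V(1) closed_Int)
    show "S \<noteq> {}" using V(2) rho by (auto simp: S_def)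
    show "0 \<le> \<rho>" "\<rho> < 1" by (fact rho)+
    show "g ` S \<subseteq> S"
    proof safe
      fix y assume y: "y \<in> S"
      have "norm (r + prod y y) \<le> norm r + norm y * norm y"
        using nrm[of y y] norm_triangle_ineq[of r "prod y y"] by linarith
      also have "\<dots> \<le> norm r + \<rho>^2"
        using y rho(1) by (simp add: S_def power2_eq_square mult_mono)
      finally show "g y \<in> S" using y step[of y] rho by (simp add: S_def g_def)
    qed
    fix x y assume xy: "x \<in> S" "y \<in> S"
    have e: "prod x x - prod y y = prod (x - y) x + prod y (x - y)"
      by (simp add: diff_left diff_right)
    have "norm (prod x x - prod y y) \<le> norm (x - y) * norm x + norm y * norm (x - y)"
      using norm_triangle_ineq[of "prod (x - y) x" "prod y (x - y)"] nrm[of "x - y" x] nrm[of y "x - y"]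
      unfolding e by linarith
    also have "\<dots> \<le> norm (x - y) * \<rho> + \<rho> * norm (x - y)"
      using xy by (intro add_mono mult_mono) (auto simp: S_def rho)
    finally have n: "norm (prod x x - prod y y) \<le> 2 * (\<rho> * norm (x - y))"
      by (simp add: algebra_simps)
    have "dist (g x) (g y) = norm ((1/2) *\<^sub>R (prod x x - prod y y))"
      by (simp add: g_def dist_norm algebra_simps)
    also have "\<dots> = norm (prod x x - prod y y) / 2" by simp
    finally show "dist (g x) (g y) \<le> \<rho> * dist x y" using n by (simp add: dist_norm)
  qed
  then obtain y where "y \<in> V" "g y = y" by (auto simp: S_def)
  then show ?thesis using that[of y] by (simp add: g_def)
qed

section \<open>Complex scalars and the involution\<close>

lemma scaleC_zero_right [simp]: "c *\<^sub>C (0::'a::complex_banach) = 0"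
  using norm_scaleC[of c "0::'a"] by simp

lemma scaleC_minus_right: "c *\<^sub>C (- x::'a::complex_banach) = - (c *\<^sub>C x)"
  using scaleC_add_right[of c x "-x"] by (simp add: eq_neg_iff_add_eq_0 add.commute)

lemma scaleC_diff_right: "c *\<^sub>C (x - y::'a::complex_banach) = c *\<^sub>C x - c *\<^sub>C y"
  using scaleC_add_right[of c x "-y"] by (simp add: scaleC_minus_right)

lemma scaleC_minus_left: "(- c) *\<^sub>C (x::'a::complex_banach) = - (c *\<^sub>C x)"
  using scaleC_scaleC[of "-1" c x] scaleC_of_real[of "-1" "c *\<^sub>C x"] by simp

lemma scaleC_one [simp]: "1 *\<^sub>C (x::'a::complex_banach) = x"
  using scaleC_of_real[of 1 x] by simp

lemma scaleC_ii [simp]: "\<i> *\<^sub>C \<i> *\<^sub>C (x::'a::complex_banach) = - x"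
  by (simp add: scaleC_scaleC scaleC_minus_left)

lemma scaleC_scaleR: "c *\<^sub>C (r *\<^sub>R (x::'a::complex_banach)) = r *\<^sub>R (c *\<^sub>C x)"
  by (simp add: scaleC_of_real[symmetric] scaleC_scaleC mult.commute)

lemma bounded_linear_scaleC: "bounded_linear (\<lambda>x::'a::complex_banach. c *\<^sub>C x)"
  by (rule bounded_linear_intro[where K = "cmod c"])
    (simp_all add: scaleC_add_right scaleC_scaleR norm_scaleC)

lemma involution_scaleR: "involution (r *\<^sub>R (a::'a::unital_cstar_algebra)) = r *\<^sub>R involution a"
  using involution_scaleC[of "of_real r" a] by (simp add: scaleC_of_real)

lemma involution_zero [simp]: "involution (0::'a::unital_cstar_algebra) = 0"
  using involution_scaleR[of 0 "0::'a"] by simp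

lemma involution_minus: "involution (- a::'a::unital_cstar_algebra) = - involution a"
  using involution_scaleR[of "-1" a] by simp

lemma involution_diff: "involution (a - b::'a::unital_cstar_algebra) = involution a - involution b"
  using involution_add[of a "-b"] by (simp add: involution_minus)

lemma involution_one [simp]: "involution (1::'a::unital_cstar_algebra) = 1"
  by (metis involution_involution involution_mult mult.right_neutral mult.left_neutral)

text \<open>The C*-identity and submultiplicativity give one inequality for every element; applying
  it to \<open>a\<close> and to \<open>involution a\<close> gives equality.\<close>

lemma norm_involution: "norm (involution (a::'a::unital_cstar_algebra)) = norm a"
proof -
  have le: "norm b \<le> norm (involution b)" for b :: 'a
  proof (cases "b = 0")
    case False
    have "norm b * norm b \<le> norm (involution b) * norm b"
      using cstar_identity[of b] norm_mult_ineq[of "involution b" b] by (simp add: power2_eq_square)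
    with False show ?thesis by simp
  qed simp
  show ?thesis using le[of a] le[of "involution a"] by (simp add: involution_involution)
qed

lemma bounded_linear_involution: "bounded_linear (involution :: 'a::unital_cstar_algebra \<Rightarrow> 'a)"
  by (rule bounded_linear_intro[where K = 1])
    (simp_all add: involution_add involution_scaleR norm_involution)

abbreviation selfadj :: "'a::unital_cstar_algebra \<Rightarrow> bool" where
  "selfadj a \<equiv> involution a = a"

lemma norm_square_selfadj: "selfadj (a::'a::unital_cstar_algebra) \<Longrightarrow> norm (a * a) = (norm a)\<^sup>2"
  using cstar_identity[of a] by simp

text \<open>The last conclusion places the root in the bicommutant of \<open>r\<close>, which later
  makes roots of commuting elements commute.\<close>

lemma selfadj_sqrt:
  fixes r :: "'a::unital_cstar_algebra"
  assumes "selfadj r" "norm r < 1"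
  obtains x where "selfadj x" "x * x = 1 - r" "\<And>c. c * r = r * c \<Longrightarrow> c * x = x * c"
proof -
  \<comment> \<open>Both conditions are equalities between continuous functions of \<open>y\<close>,
    so they define a closed set and pass to the fixed point.\<close>
  define V where "V = {y. selfadj y \<and> (\<forall>c. c * r = r * c \<longrightarrow> c * y = y * c)}"
  have V: "V = {y. selfadj y} \<inter> (\<Inter>c\<in>{c. c * r = r * c}. {y. c * y = y * c})"
    by (auto simp: V_def)
  have "closed V" unfolding V
    by (intro closed_Int closed_INT ballI closed_Collect_eq continuous_intros
        linear_continuous_on bounded_linear_involution)
  moreover have "(1/2) *\<^sub>R (r + y * y) \<in> V" if "y \<in> V" for y
  proof -
    have "c * (y * y) = y * y * c" if "c * r = r * c" for c
    proof -
      have "c * y = y * c" using \<open>y \<in> V\<close> that by (simp add: V_def)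
      then show ?thesis by (metis mult.assoc)
    qed
    then have "c * ((1/2) *\<^sub>R (r + y * y)) = (1/2) *\<^sub>R (r + y * y) * c" if "c * r = r * c" for c
      using that by (simp only: mult_scaleR_left mult_scaleR_right distrib_left distrib_right)
    moreover have "selfadj y" using that by (simp add: V_def)
    then have "selfadj ((1/2) *\<^sub>R (r + y * y))"
      using assms(1) by (simp add: involution_add involution_mult involution_scaleR)
    ultimately show ?thesis unfolding V_def by blast
  qed
  moreover have "0 \<in> V" by (simp add: V_def)
  ultimately obtain y where y: "y \<in> V" "y = (1/2) *\<^sub>R (r + y * y)"
    using quadratic_fixpoint[OF bounded_bilinear_mult norm_mult_ineq assms(2)] by blast
  have "2 *\<^sub>R y = r + y * y" by (subst y(2)) simp
  then have "r = y + y - y * y" by (simp add: scaleR_2 eq_diff_eq)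
  then have "(1 - y) * (1 - y) = 1 - r" by (simp add: left_diff_distrib right_diff_distrib)
  moreover have "selfadj (1 - y)" using y(1) by (simp add: V_def involution_diff)
  moreover have "c * (1 - y) = (1 - y) * c" if "c * r = r * c" for c
  proof -
    have "c * y = y * c" using y(1) that by (simp add: V_def)
    then show ?thesis by (simp only: left_diff_distrib right_diff_distrib) simp
  qed
  ultimately show ?thesis using that by blast
qed

text \<open>Fixed points take the place of the Neumann series: \<open>w = 1 + r * w\<close> is a
  right inverse, \<open>v = 1 + v * r\<close> a left inverse, and the two coincide.\<close>

lemma invertible_one_minus:
  fixes r :: "'a::{banach,real_normed_algebra_1}"
  assumes "norm r < 1"
  obtains w where "(1 - r) * w = 1" "w * (1 - r) = 1"
proof -
  have contr: "\<exists>w. w = 1 + h w" if "linear h" "\<And>w. norm (h w) \<le> norm r * norm w"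
    for h :: "'a \<Rightarrow> 'a"
  proof -
    have "\<exists>!w. w \<in> UNIV \<and> 1 + h w = w"
      using assms that(2) linear_diff[OF that(1)]
      by (intro Banach_fix[where c = "norm r"]) (auto simp: dist_norm complete_UNIV, metis)
    then show ?thesis by metis
  qed
  obtain w where w: "w = 1 + r * w"
    using contr[OF bounded_linear.linear[OF bounded_linear_mult_right] norm_mult_ineq] by blast
  have "norm (w * r) \<le> norm r * norm w" for w
    using norm_mult_ineq[of w r] by (simp add: mult.commute)
  then obtain v where v: "v = 1 + v * r"
    using contr[OF bounded_linear.linear[OF bounded_linear_mult_left]] by blast
  have w1: "(1 - r) * w = 1" using w by (simp add: algebra_simps)
  have v1: "v * (1 - r) = 1" using v by (simp add: algebra_simps)
  have "v = w" by (metis w1 v1 mult.assoc mult.right_neutral mult.left_neutral)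
  then show ?thesis using that w1 v1 by blast
qed

section \<open>The positive cone\<close>

text \<open>A norm characterization of positivity from which the order theory of the positive cone is
  derived without spectral theory; \<open>norm_positive_iff_cstar_positive\<close> identifies the two notions.\<close>

definition norm_positive :: "'a::unital_cstar_algebra \<Rightarrow> bool" where
  "norm_positive a \<longleftrightarrow> selfadj a \<and> (\<exists>t::real. norm (t *\<^sub>R 1 - a) \<le> t)"

lemma selfadj_scaleR_one [simp]: "selfadj (r *\<^sub>R (1::'a::unital_cstar_algebra))"
  by (simp add: involution_scaleR)

lemma norm_positive_selfadj: "norm_positive a \<Longrightarrow> selfadj a"
  by (simp add: norm_positive_def)

lemma norm_positiveI: "selfadj a \<Longrightarrow> norm (t *\<^sub>R 1 - a) \<le> t \<Longrightarrow> norm_positive a"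
  by (auto simp: norm_positive_def)

lemma norm_positive_add:
  assumes "norm_positive a" "norm_positive b"
  shows "norm_positive (a + b)"
proof -
  obtain s t :: real where st: "norm (s *\<^sub>R 1 - a) \<le> s" "norm (t *\<^sub>R 1 - b) \<le> t"
    using assms by (auto simp: norm_positive_def)
  have e: "(s + t) *\<^sub>R 1 - (a + b) = (s *\<^sub>R 1 - a) + (t *\<^sub>R 1 - b)" by (simp add: scaleR_add_left)
  have "norm ((s + t) *\<^sub>R 1 - (a + b)) \<le> s + t"
    unfolding e
    using st norm_triangle_ineq[of "s *\<^sub>R 1 - a" "t *\<^sub>R 1 - b"] by linarith
  then show ?thesis
    using assms by (intro norm_positiveI) (auto simp: norm_positive_selfadj involution_add)
qed

lemma norm_positive_scaleR:
  assumes "norm_positive a" "0 \<le> r"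
  shows "norm_positive (r *\<^sub>R a)"
proof -
  obtain t :: real where t: "norm (t *\<^sub>R 1 - a) \<le> t" using assms by (auto simp: norm_positive_def)
  have "(r * t) *\<^sub>R 1 - r *\<^sub>R a = r *\<^sub>R (t *\<^sub>R 1 - a)" by (simp add: scaleR_diff_right)
  then have "norm ((r * t) *\<^sub>R 1 - r *\<^sub>R a) \<le> r * t" using t assms(2) by (simp add: mult_left_mono)
  then show ?thesis
    using assms by (intro norm_positiveI) (auto simp: norm_positive_selfadj involution_scaleR)
qed

lemma norm_positive_scaleR_one: "0 \<le> r \<Longrightarrow> norm_positive (r *\<^sub>R (1::'a::unital_cstar_algebra))"
  by (rule norm_positiveI[of _ r]) auto

lemma norm_positive_scaleR_oneD:
  assumes "norm_positive (r *\<^sub>R (1::'a::unital_cstar_algebra))"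
  shows "0 \<le> r"
proof -
  obtain t :: real where "norm (t *\<^sub>R 1 - r *\<^sub>R (1::'a)) \<le> t"
    using assms by (auto simp: norm_positive_def)
  then have "\<bar>t - r\<bar> \<le> t" by (simp flip: scaleR_diff_left)
  then show ?thesis by linarith
qed

lemma norm_positive_norm_diff:
  assumes "selfadj a" "norm a \<le> t"
  shows "norm_positive (t *\<^sub>R 1 - a)"
  by (rule norm_positiveI[of _ t]) (use assms in \<open>auto simp: involution_diff involution_scaleR\<close>)

text \<open>The shift provides the slack that the contraction needs: with
  \<open>k = t + \<epsilon>\<close>, the element \<open>a + \<epsilon>\<close> equals
  \<open>k (1 - r)\<close> where \<open>norm r \<le> t / k < 1\<close>.\<close>

lemma norm_positive_sqrt:
  fixes a :: "'a::unital_cstar_algebra"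
  assumes "norm_positive a" "0 < \<epsilon>"
  obtains x where "selfadj x" "x * x = a + \<epsilon> *\<^sub>R 1" "\<And>c. c * a = a * c \<Longrightarrow> c * x = x * c"
proof -
  obtain t :: real where t: "norm (t *\<^sub>R 1 - a) \<le> t" using assms by (auto simp: norm_positive_def)
  have t0: "0 \<le> t" using t norm_ge_zero order_trans by blast
  define k where "k = t + \<epsilon>"
  have k: "k > 0" using t0 assms by (simp add: k_def)
  define r where "r = (1/k) *\<^sub>R (t *\<^sub>R 1 - a)"
  have "norm r < 1" using t k assms(2) by (simp add: r_def k_def)
  moreover have "selfadj r"
    using assms(1) by (simp add: r_def involution_scaleR involution_diff norm_positive_selfadj)
  ultimately obtain x where x: "selfadj x" "x * x = 1 - r" "\<And>c. c * r = r * c \<Longrightarrow> c * x = x * c"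
    using selfadj_sqrt by blast
  have "k *\<^sub>R r = t *\<^sub>R 1 - a" using k by (simp add: r_def)
  then have kr: "k *\<^sub>R (1 - r) = a + \<epsilon> *\<^sub>R 1"
    by (simp add: scaleR_diff_right) (simp add: k_def scaleR_add_left)
  show ?thesis
  proof
    show "selfadj (sqrt k *\<^sub>R x)" using x(1) by (simp add: involution_scaleR)
    show "(sqrt k *\<^sub>R x) * (sqrt k *\<^sub>R x) = a + \<epsilon> *\<^sub>R 1" using x(2) k kr by simp
    fix c assume "c * a = a * c"
    then have "c * r = r * c"
      unfolding r_def
      by (simp only: mult_scaleR_left mult_scaleR_right left_diff_distrib right_diff_distrib) simp
    then have "c * x = x * c" by (rule x(3))
    then show "c * (sqrt k *\<^sub>R x) = (sqrt k *\<^sub>R x) * c"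
      by (simp only: mult_scaleR_left mult_scaleR_right)
  qed
qed

text \<open>Here \<open>z = u + \<i>v\<close> has \<open>z\<^sup>*z = u\<^sup>2 + v\<^sup>2\<close> and real part \<open>u\<close>.\<close>

lemma norm_le_sum_squares:
  fixes u v :: "'a::unital_cstar_algebra"
  assumes "selfadj u" "selfadj v" "u * v = v * u"
  shows "(norm u)\<^sup>2 \<le> norm (u * u + v * v)"
proof -
  define z where "z = u + \<i> *\<^sub>C v"
  have z': "involution z = u - \<i> *\<^sub>C v"
    using assms by (simp add: z_def involution_add involution_scaleC scaleC_minus_left)
  have "involution z * z = u * u + v * v"
    unfolding z' unfolding z_def
    by (simp add: left_diff_distrib distrib_left mult_scaleC_left mult_scaleC_right assms(3)
        scaleC_diff_right)
  then have z: "(norm z)\<^sup>2 = norm (u * u + v * v)" using cstar_identity[of z] by simp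
  have "2 *\<^sub>R u = z + involution z" unfolding z' by (simp add: z_def scaleR_2)
  then have "norm (2 *\<^sub>R u) = norm (z + involution z)" by (rule arg_cong)
  then have "norm u \<le> norm z"
    using norm_triangle_ineq[of z "involution z"] norm_involution[of z] by simp
  then show ?thesis unfolding z[symmetric] by (rule power_mono) simp
qed

text \<open>Scale \<open>x\<close> to \<open>y\<close> with \<open>y^2 = r\<close> and
  \<open>norm r < 1\<close>. The root \<open>w\<close> of \<open>1 - r\<close> commutes with
  \<open>y\<close> and \<open>w^2 + y^2 = 1\<close>, so \<open>norm_le_sum_squares\<close> gives
  \<open>norm (1 - r) = (norm w)^2 \<le> 1\<close>.\<close>

lemma norm_positive_square:
  fixes x :: "'a::unital_cstar_algebra"
  assumes "selfadj x"
  shows "norm_positive (x * x)"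
proof -
  define t where "t = (norm x)\<^sup>2 + 1"
  have t: "t > 0" by (simp add: t_def add_nonneg_pos)
  define r where "r = (1/t) *\<^sub>R (x * x)"
  have "norm r < 1" using t by (simp add: r_def norm_square_selfadj[OF assms]) (simp add: t_def)
  moreover have r: "selfadj r" by (simp add: r_def involution_scaleR involution_mult assms)
  ultimately obtain w where w: "selfadj w" "w * w = 1 - r" "\<And>c. c * r = r * c \<Longrightarrow> c * w = w * c"
    using selfadj_sqrt by blast
  have "x * w = w * x" by (rule w(3)) (simp add: r_def mult.assoc)
  define y where "y = (1 / sqrt t) *\<^sub>R x"
  have y: "selfadj y" by (simp add: y_def involution_scaleR assms)
  have "w * y = y * w" by (simp add: y_def \<open>x * w = w * x\<close>)
  moreover have "y * y = r" using t by (simp add: y_def r_def)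
  ultimately have "(norm w)\<^sup>2 \<le> norm (w * w + r)"
    using norm_le_sum_squares[OF w(1) y] by simp
  then have "norm (1 - r) \<le> 1"
    unfolding norm_square_selfadj[OF w(1), symmetric] w(2) by simp
  moreover have "t *\<^sub>R 1 - x * x = t *\<^sub>R (1 - r)" using t by (simp add: r_def scaleR_diff_right)
  ultimately have "norm (t *\<^sub>R 1 - x * x) \<le> t" using t by simp
  then show ?thesis by (intro norm_positiveI) (simp_all add: involution_mult assms)
qed

text \<open>Roots \<open>u\<close> of \<open>a + \<epsilon>\<close> and \<open>v\<close> of
  \<open>t - a + \<epsilon>\<close> commute, and \<open>u^2 + v^2\<close> is the scalar
  \<open>t + 2 \<epsilon>\<close>, so \<open>norm_le_sum_squares\<close> bounds \<open>u^2\<close>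
  and hence \<open>a\<close>.\<close>

lemma norm_le_of_norm_positive:
  fixes a :: "'a::unital_cstar_algebra"
  assumes "norm_positive a" "norm_positive (t *\<^sub>R 1 - a)"
  shows "norm a \<le> t"
proof (rule field_le_epsilon)
  fix e :: real assume e: "0 < e"
  \<comment> \<open>Two thirds of \<open>e\<close> are spent on the scalar
    \<open>t + 2 \<epsilon>\<close>, the last third on the passage from \<open>u * u\<close> back to
    \<open>a\<close>.\<close>
  define \<epsilon> where "\<epsilon> = e / 3"
  have \<epsilon>: "\<epsilon> > 0" using e by (simp add: \<epsilon>_def)
  obtain u where u: "selfadj u" "u * u = a + \<epsilon> *\<^sub>R 1" "\<And>c. c * a = a * c \<Longrightarrow> c * u = u * c"
    using norm_positive_sqrt[OF assms(1) \<epsilon>] by blast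
  obtain v where v: "selfadj v" "v * v = t *\<^sub>R 1 - a + \<epsilon> *\<^sub>R 1"
      "\<And>c. c * (t *\<^sub>R 1 - a) = (t *\<^sub>R 1 - a) * c \<Longrightarrow> c * v = v * c"
    using norm_positive_sqrt[OF assms(2) \<epsilon>] by blast
  have "a * u = u * a" by (rule u(3)) simp
  then have uv: "u * v = v * u" by (intro v(3)) (simp add: left_diff_distrib right_diff_distrib)
  have "u * u + v * v = (t + 2 * \<epsilon>) *\<^sub>R 1" by (simp add: u v scaleR_add_left flip: scaleR_2)
  then have "norm (u * u) \<le> \<bar>t + 2 * \<epsilon>\<bar>"
    using norm_le_sum_squares[OF u(1) v(1) uv] norm_square_selfadj[OF u(1)] by simp
  moreover have "0 \<le> t" using norm_positive_scaleR_oneD[of t] norm_positive_add[OF assms] by simp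
  ultimately have "norm (u * u) \<le> t + 2 * \<epsilon>" using \<epsilon> by simp
  moreover have "norm a \<le> norm (u * u) + \<epsilon>"
    using norm_triangle_ineq4[of "u * u" "\<epsilon> *\<^sub>R 1"] \<epsilon> by (simp add: u)
  ultimately show "norm a \<le> t + e" by (simp add: \<epsilon>_def)
qed

text \<open>With the existential \<open>t\<close> replaced by \<open>norm a\<close>, the condition
  is visibly closed in \<open>a\<close>.\<close>

lemma norm_positive_iff_norm:
  fixes a :: "'a::unital_cstar_algebra"
  shows "norm_positive a \<longleftrightarrow> selfadj a \<and> norm (norm a *\<^sub>R 1 - a) \<le> norm a"
proof (intro iffI conjI)
  assume a: "norm_positive a"
  show sa: "selfadj a" by (rule norm_positive_selfadj[OF a])
  show "norm (norm a *\<^sub>R 1 - a) \<le> norm a"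
    by (rule norm_le_of_norm_positive) (simp_all add: a sa norm_positive_norm_diff)
qed (auto simp: norm_positive_def)

lemma closed_norm_positive: "closed {a::'a::unital_cstar_algebra. norm_positive a}"
  unfolding norm_positive_iff_norm Collect_conj_eq
  by (intro closed_Int closed_Collect_eq closed_Collect_le continuous_intros
      linear_continuous_on bounded_linear_involution)

text \<open>By closedness of the cone \<epsilon> may tend to 0 along any direction \<open>b\<close>.
  This removes the shifts introduced by \<open>norm_positive_sqrt\<close>.\<close>

lemma norm_positive_of_perturb:
  fixes a b :: "'a::unital_cstar_algebra"
  assumes "\<And>\<epsilon>. 0 < \<epsilon> \<Longrightarrow> norm_positive (a + \<epsilon> *\<^sub>R b)"
  shows "norm_positive a"
proof -
  have "((\<lambda>\<epsilon>. a + \<epsilon> *\<^sub>R b) \<longlongrightarrow> a + 0 *\<^sub>R b) (at_right 0)" by (intro tendsto_intros)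
  moreover have "\<forall>\<^sub>F \<epsilon> in at_right 0. a + \<epsilon> *\<^sub>R b \<in> {a. norm_positive a}"
    using assms by (auto simp: eventually_at_filter intro!: always_eventually)
  ultimately have "a + 0 *\<^sub>R b \<in> {a. norm_positive a}"
    by (intro Lim_in_closed_set[OF closed_norm_positive]) auto
  then show ?thesis by simp
qed

text \<open>For commuting roots \<open>x\<close> of \<open>a + \<epsilon>\<close> and
  \<open>y\<close> of \<open>b + \<delta>\<close>, the square of \<open>x * y\<close> is
  \<open>x (b + \<delta>) x\<close>. Letting \<delta> and then \<epsilon> tend to 0 leaves
  \<open>a * b\<close>.\<close>

lemma norm_positive_mult:
  fixes a b :: "'a::unital_cstar_algebra"
  assumes a: "norm_positive a" and b: "norm_positive b" and ab: "a * b = b * a"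
  shows "norm_positive (a * b)"
proof (rule norm_positive_of_perturb)
  fix \<epsilon> :: real assume "0 < \<epsilon>"
  then obtain x where x: "selfadj x" "x * x = a + \<epsilon> *\<^sub>R 1" "\<And>c. c * a = a * c \<Longrightarrow> c * x = x * c"
    using norm_positive_sqrt[OF a] by blast
  have xb: "b * x = x * b" by (rule x(3)) (rule ab[symmetric])
  have "norm_positive (x * b * x)"
  proof (rule norm_positive_of_perturb)
    fix \<delta> :: real assume "0 < \<delta>"
    then obtain y where y: "selfadj y" "y * y = b + \<delta> *\<^sub>R 1" "\<And>c. c * b = b * c \<Longrightarrow> c * y = y * c"
      using norm_positive_sqrt[OF b] by blast
    have xy: "x * y = y * x" by (rule y(3)) (rule xb[symmetric])
    have "norm_positive ((x * y) * (x * y))"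
      by (rule norm_positive_square) (simp add: involution_mult x(1) y(1) xy)
    also have "(x * y) * (x * y) = x * (y * y) * x" by (metis mult.assoc xy)
    finally show "norm_positive (x * b * x + \<delta> *\<^sub>R (x * x))"
      by (simp add: y(2) distrib_left distrib_right)
  qed
  also have "x * b * x = (x * x) * b" by (metis mult.assoc xb)
  finally show "norm_positive (a * b + \<epsilon> *\<^sub>R b)" by (simp add: x(2) distrib_right)
qed

text \<open>With \<open>x\<close> a root of \<open>a + \<epsilon>\<close>, the square of
  \<open>b * x\<close> is \<open>b (a + \<epsilon>) b = b + \<epsilon> b^2\<close>.\<close>

lemma norm_positive_inverse:
  fixes a b :: "'a::unital_cstar_algebra"
  assumes a: "norm_positive a" and ab: "a * b = 1" "b * a = 1"
  shows "norm_positive b"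
proof (rule norm_positive_of_perturb)
  have sa: "selfadj a" by (rule norm_positive_selfadj[OF a])
  have "involution b * a = 1" by (metis ab(1) involution_mult involution_one sa)
  then have sb: "selfadj b" by (metis ab(1) mult.assoc mult.left_neutral mult.right_neutral)
  fix \<epsilon> :: real assume "0 < \<epsilon>"
  then obtain x where x: "selfadj x" "x * x = a + \<epsilon> *\<^sub>R 1" "\<And>c. c * a = a * c \<Longrightarrow> c * x = x * c"
    using norm_positive_sqrt[OF a] by blast
  have bx: "b * x = x * b" by (rule x(3)) (simp add: ab)
  have "norm_positive ((b * x) * (b * x))"
    by (rule norm_positive_square) (simp add: involution_mult x(1) sb bx)
  also have "(b * x) * (b * x) = b * (x * x) * b" by (metis mult.assoc bx)
  also have "\<dots> = b + \<epsilon> *\<^sub>R (b * b)" by (simp add: x(2) distrib_left distrib_right ab)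
  finally show "norm_positive (b + \<epsilon> *\<^sub>R (b * b))" .
qed

text \<open>The product of \<open>a\<close> with the positive element \<open>norm b - b\<close> is
  \<open>norm b\<close> times \<open>a\<close>, minus 1; dividing by \<open>norm b\<close> yields
  the gap \<open>1 / norm b\<close>.\<close>

lemma norm_positive_invertible_gap:
  fixes a b :: "'a::unital_cstar_algebra"
  assumes a: "norm_positive a" and ab: "a * b = 1" "b * a = 1"
  obtains \<delta> where "0 < \<delta>" "norm_positive (a - \<delta> *\<^sub>R 1)"
proof -
  have b: "norm_positive b" by (rule norm_positive_inverse[OF a ab])
  have "b \<noteq> 0" using ab by auto
  then have k: "norm b > 0" by simp
  have "norm_positive (norm b *\<^sub>R 1 - b)"
    by (rule norm_positive_norm_diff) (simp_all add: norm_positive_selfadj[OF b])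
  then have "norm_positive (a * (norm b *\<^sub>R 1 - b))"
    by (intro norm_positive_mult[OF a]) (simp_all add: right_diff_distrib left_diff_distrib ab)
  then have "norm_positive ((1 / norm b) *\<^sub>R (a * (norm b *\<^sub>R 1 - b)))"
    by (rule norm_positive_scaleR) simp
  also have "(1 / norm b) *\<^sub>R (a * (norm b *\<^sub>R 1 - b)) = a - (1 / norm b) *\<^sub>R 1"
    using k by (simp add: right_diff_distrib ab scaleR_diff_right)
  finally show ?thesis using that[of "1 / norm b"] k by simp
qed

text \<open>The rescaling of \<open>norm_positive_sqrt\<close>, now combined with invertibility of
  \<open>1 - r\<close>.\<close>

lemma norm_positive_add_invertible:
  fixes a :: "'a::unital_cstar_algebra"
  assumes "norm_positive a" "0 < \<epsilon>"
  obtains b where "(a + \<epsilon> *\<^sub>R 1) * b = 1" "b * (a + \<epsilon> *\<^sub>R 1) = 1"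
proof -
  obtain t :: real where t: "norm (t *\<^sub>R 1 - a) \<le> t" using assms by (auto simp: norm_positive_def)
  have t0: "0 \<le> t" using t norm_ge_zero order_trans by blast
  define k where "k = t + \<epsilon>"
  have k: "k > 0" using t0 assms by (simp add: k_def)
  define r where "r = (1/k) *\<^sub>R (t *\<^sub>R 1 - a)"
  have "norm r < 1" using t k assms(2) by (simp add: r_def k_def)
  then obtain w where w: "(1 - r) * w = 1" "w * (1 - r) = 1" using invertible_one_minus by blast
  have "k *\<^sub>R r = t *\<^sub>R 1 - a" using k by (simp add: r_def)
  then have "a + \<epsilon> *\<^sub>R 1 = k *\<^sub>R (1 - r)"
    by (simp add: scaleR_diff_right) (simp add: k_def scaleR_add_left)
  with w k that[of "(1/k) *\<^sub>R w"] show ?thesis by simp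
qed

lemma norm_positive_iff_cstar_positive: "norm_positive a \<longleftrightarrow> cstar_positive a"
proof
  assume a: "norm_positive a"
  have sa: "selfadj a" by (rule norm_positive_selfadj[OF a])
  have "c \<in> nonneg_Reals" if c: "c \<in> spectrum a" for c
  proof (rule ccontr)
    assume nn: "c \<notin> nonneg_Reals"
    define x where "x = a - Re c *\<^sub>R 1"
    have sx: "selfadj x" by (simp add: x_def involution_diff sa)
    have cx: "c *\<^sub>C 1 - a = \<i> *\<^sub>C (Im c *\<^sub>R 1) - x"
    proof -
      have "c *\<^sub>C (1::'a) = (of_real (Re c) + \<i> * of_real (Im c)) *\<^sub>C 1" by (simp flip: complex_eq)
      also have "\<dots> = Re c *\<^sub>R 1 + \<i> *\<^sub>C (Im c *\<^sub>R 1)"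
        by (simp only: scaleC_add_left scaleC_of_real scaleC_scaleC[symmetric])
      finally show ?thesis by (simp add: x_def)
    qed
    have "\<exists>b. (c *\<^sub>C 1 - a) * b = 1 \<and> b * (c *\<^sub>C 1 - a) = 1"
    proof (cases "Im c = 0")
      case True
      \<comment> \<open>For real \<open>c < 0\<close>, the element \<open>c - a\<close> is the
        negative of \<open>a\<close> plus a positive scalar, hence invertible.\<close>
      then have "Re c < 0" using nn by (auto simp: complex_nonneg_Reals_iff)
      then obtain b where b: "(a + (- Re c) *\<^sub>R 1) * b = 1" "b * (a + (- Re c) *\<^sub>R 1) = 1"
        using norm_positive_add_invertible[OF a, of "- Re c"] by auto
      have e: "c *\<^sub>C 1 - a = - (a + (- Re c) *\<^sub>R 1)" unfolding cx using True by (simp add: x_def)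
      have "(c *\<^sub>C 1 - a) * (- b) = 1 \<and> (- b) * (c *\<^sub>C 1 - a) = 1"
        unfolding e minus_mult_minus using b by blast
      then show ?thesis by blast
    next
      case False
      \<comment> \<open>For non-real \<open>c\<close>, multiplying \<open>c - a\<close> by
        \<open>y\<close> on either side gives \<open>- (x^2 + (Im c)^2)\<close>, a square plus a
        positive scalar up to sign, hence invertible.\<close>
      define y where "y = \<i> *\<^sub>C (Im c *\<^sub>R (1::'a)) + x"
      have yl: "y * (\<i> *\<^sub>C (Im c *\<^sub>R 1) - x) = - (x * x + (Im c)\<^sup>2 *\<^sub>R 1)"
        and yr: "(\<i> *\<^sub>C (Im c *\<^sub>R 1) - x) * y = - (x * x + (Im c)\<^sup>2 *\<^sub>R 1)"
        unfolding y_def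
        by (simp_all add: distrib_left distrib_right left_diff_distrib right_diff_distrib
            mult_scaleC_left mult_scaleC_right scaleC_scaleR power2_eq_square scaleC_add_right
            scaleC_diff_right scaleR_diff_right)
      obtain b where b: "(x * x + (Im c)\<^sup>2 *\<^sub>R 1) * b = 1" "b * (x * x + (Im c)\<^sup>2 *\<^sub>R 1) = 1"
        using norm_positive_add_invertible[OF norm_positive_square[OF sx], of "(Im c)\<^sup>2"] False by auto
      have l: "(- (b * y)) * (c *\<^sub>C 1 - a) = 1" unfolding cx
        by (simp only: mult_minus_left mult_minus_right mult.assoc yl minus_minus b)
      have r: "(c *\<^sub>C 1 - a) * (- (y * b)) = 1" unfolding cx
        by (simp only: mult_minus_left mult_minus_right mult.assoc[symmetric] yr minus_minus b)
      have "- (b * y) = - (y * b)" using l r by (metis mult.assoc mult.left_neutral mult.right_neutral)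
      then show ?thesis using l r by metis
    qed
    then show False using c unfolding spectrum_def by blast
  qed
  with sa show "cstar_positive a" by (auto simp: cstar_positive_def)
next
  text \<open>The largest \<open>t\<close> with \<open>a - t\<close> norm-positive lies in the spectrum, by
    \<open>norm_positive_invertible_gap\<close>.\<close>
  assume a: "cstar_positive a"
  then have sa: "selfadj a" and sp: "spectrum a \<subseteq> nonneg_Reals" by (auto simp: cstar_positive_def)
  define S where "S = {s. norm_positive (a - s *\<^sub>R 1)}"
  have "closed S"
  proof -
    have "closed ((\<lambda>s. a - s *\<^sub>R 1) -` {a. norm_positive a})"
      by (intro closed_vimage closed_norm_positive continuous_intros)
    then show ?thesis by (simp add: S_def vimage_def)
  qed
  have "norm_positive (norm a *\<^sub>R 1 - (- a))"
    by (rule norm_positive_norm_diff) (simp_all add: sa involution_minus)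
  then have ne: "- norm a \<in> S" by (simp add: S_def add.commute)
  have bd: "s \<le> norm a" if "s \<in> S" for s
  proof -
    have "norm_positive ((norm a *\<^sub>R 1 - a) + (a - s *\<^sub>R 1))"
      using that by (intro norm_positive_add norm_positive_norm_diff) (simp_all add: sa S_def)
    also have "(norm a *\<^sub>R 1 - a) + (a - s *\<^sub>R 1) = (norm a - s) *\<^sub>R 1" by (simp add: scaleR_diff_left)
    finally show ?thesis using norm_positive_scaleR_oneD[of "norm a - s"] by simp
  qed
  then have bdd: "bdd_above S" by (auto simp: bdd_above_def)
  define t where "t = Sup S"
  have "t \<in> S" unfolding t_def using ne bdd \<open>closed S\<close> by (intro closed_contains_Sup) auto
  have "t \<ge> 0"
  proof (rule ccontr)
    assume t: "\<not> t \<ge> 0"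
    then have "complex_of_real t \<notin> spectrum a" using sp by (auto simp: complex_nonneg_Reals_iff)
    then obtain b where "(t *\<^sub>R 1 - a) * b = 1" "b * (t *\<^sub>R 1 - a) = 1"
      by (auto simp: spectrum_def scaleC_of_real)
    then have "(a - t *\<^sub>R 1) * (- b) = 1" "(- b) * (a - t *\<^sub>R 1) = 1"
      by (simp_all add: left_diff_distrib right_diff_distrib)
    then obtain \<delta> where \<delta>: "0 < \<delta>" "norm_positive (a - t *\<^sub>R 1 - \<delta> *\<^sub>R 1)"
      using norm_positive_invertible_gap \<open>t \<in> S\<close> unfolding S_def by (metis mem_Collect_eq)
    then have "t + \<delta> \<in> S" by (simp add: S_def scaleR_add_left diff_diff_eq)
    then have "t + \<delta> \<le> t" unfolding t_def using bdd by (rule cSup_upper)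
    with \<delta> show False by simp
  qed
  then have "norm_positive ((a - t *\<^sub>R 1) + t *\<^sub>R 1)"
    using \<open>t \<in> S\<close> by (intro norm_positive_add norm_positive_scaleR_one) (simp_all add: S_def)
  then show "norm_positive a" by simp
qed

lemmas cstar_positive_add = norm_positive_add[unfolded norm_positive_iff_cstar_positive]
  and cstar_positive_scaleR = norm_positive_scaleR[unfolded norm_positive_iff_cstar_positive]
  and cstar_positive_scaleR_one = norm_positive_scaleR_one[unfolded norm_positive_iff_cstar_positive]
  and cstar_positive_norm_diff = norm_positive_norm_diff[unfolded norm_positive_iff_cstar_positive]
  and cstar_positive_sqrt = norm_positive_sqrt[unfolded norm_positive_iff_cstar_positive]
  and cstar_positive_of_perturb = norm_positive_of_perturb[unfolded norm_positive_iff_cstar_positive]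
  and cstar_positive_mult = norm_positive_mult[unfolded norm_positive_iff_cstar_positive]
  and cstar_positive_inverse = norm_positive_inverse[unfolded norm_positive_iff_cstar_positive]
  and cstar_positive_add_invertible =
    norm_positive_add_invertible[unfolded norm_positive_iff_cstar_positive]
  and closed_cstar_positive = closed_norm_positive[unfolded norm_positive_iff_cstar_positive]

lemma cstar_positive_selfadj: "cstar_positive a \<Longrightarrow> selfadj a"
  by (simp add: cstar_positive_def)

lemma cstar_positive_zero [simp]: "cstar_positive (0::'a::unital_cstar_algebra)"
  using cstar_positive_scaleR_one[where 'a = 'a, of 0] by simp

lemma cstar_positive_sum: "(\<And>i. i \<in> F \<Longrightarrow> cstar_positive (f i)) \<Longrightarrow> cstar_positive (sum f F)"
  by (induction F rule: infinite_finite_induct) (auto intro: cstar_positive_add)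

text \<open>Both \<open>a\<close> and \<open>norm b - a = (norm b - b) + (b - a)\<close> are
  positive, so \<open>norm_le_of_norm_positive\<close> applies.\<close>

lemma cstar_positive_norm_mono:
  fixes a b :: "'a::unital_cstar_algebra"
  assumes a: "cstar_positive a" and ab: "cstar_positive (b - a)"
  shows "norm a \<le> norm b"
proof -
  have "cstar_positive b" using cstar_positive_add[OF a ab] by simp
  then have "cstar_positive (norm b *\<^sub>R 1 - b)"
    by (intro cstar_positive_norm_diff cstar_positive_selfadj) simp_all
  from cstar_positive_add[OF this ab] have "cstar_positive (norm b *\<^sub>R 1 - a)" by simp
  then show ?thesis
    using a norm_le_of_norm_positive unfolding norm_positive_iff_cstar_positive by blast
qed

section \<open>Sesquilinear forms and the inner product\<close>

definition sesquilinear :: "('h::complex_banach \<Rightarrow> 'h \<Rightarrow> 'a::complex_banach) \<Rightarrow> bool" where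
  "sesquilinear B \<longleftrightarrow> (\<forall>f f' g. B (f + f') g = B f g + B f' g) \<and>
    (\<forall>f g g'. B f (g + g') = B f g + B f g') \<and>
    (\<forall>c f g. B (c *\<^sub>C f) g = c *\<^sub>C B f g) \<and> (\<forall>c f g. B f (c *\<^sub>C g) = cnj c *\<^sub>C B f g)"

context
  fixes B :: "'h::complex_banach \<Rightarrow> 'h \<Rightarrow> 'a::complex_banach"
  assumes B: "sesquilinear B"
begin

lemma sesquilinear_simps:
  "B (f + f') g = B f g + B f' g" "B f (g + g') = B f g + B f g'"
  "B (c *\<^sub>C f) g = c *\<^sub>C B f g" "B f (c *\<^sub>C g) = cnj c *\<^sub>C B f g"
  "B (r *\<^sub>R f) g = r *\<^sub>R B f g" "B f (r *\<^sub>R g) = r *\<^sub>R B f g"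
  "B (- f) g = - B f g" "B f (- g) = - B f g"
  "B (f - f') g = B f g - B f' g" "B f (g - g') = B f g - B f g'"
  "B 0 g = 0" "B f 0 = 0"
proof -
  show a: "\<And>f f' g. B (f + f') g = B f g + B f' g" "\<And>f g g'. B f (g + g') = B f g + B f g'"
    and c: "\<And>c f g. B (c *\<^sub>C f) g = c *\<^sub>C B f g" "\<And>c f g. B f (c *\<^sub>C g) = cnj c *\<^sub>C B f g"
    using B by (auto simp: sesquilinear_def)
  show r: "\<And>r f g. B (r *\<^sub>R f) g = r *\<^sub>R B f g" "\<And>r f g. B f (r *\<^sub>R g) = r *\<^sub>R B f g"
    using c(1)[of "complex_of_real _"] c(2)[of _ "complex_of_real _"]
    by (simp_all add: scaleC_of_real)
  show m: "\<And>f g. B (- f) g = - B f g" "\<And>f g. B f (- g) = - B f g"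
    using r(1)[of "-1"] r(2)[of _ "-1"] by simp_all
  show "\<And>f f' g. B (f - f') g = B f g - B f' g" "\<And>f g g'. B f (g - g') = B f g - B f g'"
    unfolding diff_conv_add_uminus by (simp_all only: a m)
  show "\<And>g. B 0 g = 0" "\<And>f. B f 0 = 0" using r(1)[of 0] r(2)[of _ 0] by simp_all
qed

text \<open>Carries summability, norm bounds and equality from the diagonal of a form to all its
  values.\<close>

lemma polarization:
  "B f g = (1/4) *\<^sub>R (B (f + g) (f + g) - B (f - g) (f - g) +
    (\<i> *\<^sub>C B (f + \<i> *\<^sub>C g) (f + \<i> *\<^sub>C g) - \<i> *\<^sub>C B (f - \<i> *\<^sub>C g) (f - \<i> *\<^sub>C g)))"
proof -
  have "B (f + g) (f + g) - B (f - g) (f - g) +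
    (\<i> *\<^sub>C B (f + \<i> *\<^sub>C g) (f + \<i> *\<^sub>C g) - \<i> *\<^sub>C B (f - \<i> *\<^sub>C g) (f - \<i> *\<^sub>C g))
    = B f g + B f g + B f g + B f g"
    by (simp add: sesquilinear_simps scaleC_add_right scaleC_diff_right scaleC_minus_left scaleC_minus_right)
  also have "\<dots> = 4 *\<^sub>R B f g"
    by (metis (no_types) add.assoc numeral_Bit0 scaleR_add_left scaleR_2)
  finally show ?thesis by simp
qed

text \<open>For unit vectors the four arguments in \<open>polarization\<close> have norm at most 2,
  so each diagonal value is at most \<open>4 * K\<close>; homogeneity does the rest.\<close>

lemma sesquilinear_bound:
  assumes K: "\<And>f. norm (B f f) \<le> K * (norm f)\<^sup>2"
  shows "norm (B f g) \<le> 4 * K * norm f * norm g"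
proof -
  have unit: "norm (B f g) \<le> 4 * K" if "norm f = 1" "norm g = 1" for f g
  proof -
    have K0: "0 \<le> K" using K[of f] that order_trans[OF norm_ge_zero K[of f]] by simp
    have q: "norm (B h h) \<le> 4 * K" if "norm h \<le> 2" for h
    proof -
      have "(norm h)\<^sup>2 \<le> 2\<^sup>2" using that by (intro power_mono) auto
      then show ?thesis using K[of h] K0 mult_left_mono[of "(norm h)\<^sup>2" 4 K] by simp
    qed
    have n: "norm (f + g) \<le> 2" "norm (f - g) \<le> 2"
      "norm (f + \<i> *\<^sub>C g) \<le> 2" "norm (f - \<i> *\<^sub>C g) \<le> 2"
      using norm_triangle_ineq[of f g] norm_triangle_ineq4[of f g]
        norm_triangle_ineq[of f "\<i> *\<^sub>C g"] norm_triangle_ineq4[of f "\<i> *\<^sub>C g"] that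
      by (simp_all add: norm_scaleC)
    have "4 * norm (B f g) = norm (4 *\<^sub>R B f g)" by simp
    also have "4 *\<^sub>R B f g = B (f + g) (f + g) - B (f - g) (f - g) +
      (\<i> *\<^sub>C B (f + \<i> *\<^sub>C g) (f + \<i> *\<^sub>C g) - \<i> *\<^sub>C B (f - \<i> *\<^sub>C g) (f - \<i> *\<^sub>C g))"
      by (subst polarization) simp
    also have "norm \<dots> \<le> (4 * K + 4 * K) + (4 * K + 4 * K)"
      using n by (intro norm_triangle_mono norm_triangle_le_diff add_mono)
        (auto simp: norm_scaleC q intro!: order_trans[OF norm_triangle_ineq4] add_mono)
    finally show ?thesis by simp
  qed
  show ?thesis
  proof (cases "f = 0 \<or> g = 0")
    case True
    then show ?thesis by (auto simp: sesquilinear_simps)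
  next
    case False
    then have "norm (B ((1 / norm f) *\<^sub>R f) ((1 / norm g) *\<^sub>R g)) \<le> 4 * K" by (intro unit) auto
    then have "norm (B f g) / (norm f * norm g) \<le> 4 * K"
      by (simp add: sesquilinear_simps mult.commute)
    then show ?thesis using False by (simp add: divide_le_eq mult.assoc)
  qed
qed

end

lemma bounded_clinearD:
  assumes "bounded_clinear T"
  shows "bounded_linear T" "T (c *\<^sub>C f) = c *\<^sub>C T f" "T (f + g) = T f + T g"
    "T (f - g) = T f - T g" "T (r *\<^sub>R f) = r *\<^sub>R T f" "T 0 = 0"
  using assms linear_add[of T] linear_diff[of T] linear_scale[of T] linear_0[of T]
  by (auto simp: bounded_clinear_def bounded_linear.linear)

lemma bounded_clinear_compose: "bounded_clinear S \<Longrightarrow> bounded_clinear T \<Longrightarrow> bounded_clinear (\<lambda>f. S (T f))"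
  by (simp add: bounded_clinear_def bounded_linear_compose)

context hilbert_module
begin

text \<open>Complex homogeneity comes from the module structure, since a scalar \<open>c\<close>
  acts as the algebra element \<open>c\<close> times 1.\<close>

lemma sesquilinear_ip: "sesquilinear ip"
proof -
  have l: "ip (c *\<^sub>C f) g = c *\<^sub>C ip f g" for c f g
    using ip_act_left[of "c *\<^sub>C 1" f g] by (simp add: act_scaleC act_one mult_scaleC_left)
  have "ip f (g + h) = ip f g + ip f h" for f g h
    by (metis ip_involution ip_add_left involution_add)
  moreover have "ip f (c *\<^sub>C g) = cnj c *\<^sub>C ip f g" for c f g
    by (metis ip_involution l involution_scaleC)
  ultimately show ?thesis by (simp add: sesquilinear_def ip_add_left l)
qed

lemmas ip_simps = sesquilinear_simps[OF sesquilinear_ip]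

lemma ip_act_right: "ip f (act a g) = ip f g * involution a"
  by (metis ip_act_left ip_involution involution_mult)

lemma ip_eqI: "(\<And>h. ip f h = ip g h) \<Longrightarrow> f = g"
  using ip_definite[of "f - g"] by (simp add: ip_simps)

lemma norm_sq: "(norm f)\<^sup>2 = norm (ip f f)"
  by (simp add: norm_eq)

text \<open>A substitute for Cauchy-Schwarz obtained by polarization; the factor 4 is harmless where
  only continuity or a limit matters.\<close>

lemma norm_ip_le: "norm (ip f g) \<le> 4 * norm f * norm g"
  using sesquilinear_bound[OF sesquilinear_ip, of 1] by (simp add: norm_sq)

lemma bounded_bilinear_ip: "bounded_bilinear ip"
proof
  show "\<exists>K. \<forall>a b. norm (ip a b) \<le> norm a * norm b * K"
    using norm_ip_le by (intro exI[of _ 4]) (simp add: mult_ac)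
qed (simp_all add: ip_simps)

text \<open>The general positivity of \<open>x x\<^sup>*\<close> (Kaplansky) is avoided: for \<open>x = \<langle>f, \<psi>\<rangle>\<close> and \<open>p = \<langle>\<psi>, \<psi>\<rangle>\<close>
  one has \<open>x y p y\<^sup>* x\<^sup>* = \<langle>x y \<psi>, x y \<psi>\<rangle>\<close>, and \<open>x e p x\<^sup>*\<close> with \<open>e = (p + \<epsilon>)\<^sup>-\<^sup>1\<close> differs from
  \<open>x x\<^sup>*\<close> by \<open>\<epsilon> x e x\<^sup>*\<close>, which tends to zero.\<close>

lemma ip_mult_ip_positive: "cstar_positive (ip f \<psi> * ip \<psi> f)"
proof -
  define p where "p = ip \<psi> \<psi>"
  define x where "x = ip f \<psi>"
  have p: "cstar_positive p" by (simp add: p_def ip_positive)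
  have x': "involution x = ip \<psi> f" by (simp add: x_def ip_involution)
  have conj: "cstar_positive (x * y * p * involution y * ip \<psi> f)" for y
    using ip_positive[of "act (x * y) \<psi>"]
    by (simp add: ip_act_left ip_act_right p_def involution_mult x' mult.assoc)
  \<comment> \<open>Passes from \<open>y * involution y\<close> to a positive \<open>e\<close>
    commuting with \<open>p\<close>, by taking for \<open>y\<close> a root of
    \<open>e + \<delta>\<close> and letting \<delta> tend to 0.\<close>
  have conj_e: "cstar_positive (x * e * p * ip \<psi> f)" if e: "cstar_positive e" "e * p = p * e" for e
  proof (rule cstar_positive_of_perturb)
    fix \<delta> :: real assume "0 < \<delta>"
    then obtain c where c: "selfadj c" "c * c = e + \<delta> *\<^sub>R 1" "\<And>d. d * e = e * d \<Longrightarrow> d * c = c * d"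
      using cstar_positive_sqrt[OF e(1)] by blast
    have "p * c = c * p" by (rule c(3)) (rule e(2)[symmetric])
    then have "x * c * p * involution c * ip \<psi> f = x * (c * c) * p * ip \<psi> f"
      by (metis c(1) mult.assoc)
    then show "cstar_positive (x * e * p * ip \<psi> f + \<delta> *\<^sub>R (x * p * ip \<psi> f))"
      using conj[of c] by (simp add: c(2) distrib_left distrib_right)
  qed
  have approx: "\<exists>a. cstar_positive a \<and> norm (x * ip \<psi> f - a) \<le> 4 * (norm f * norm \<psi>) * (4 * norm f * sqrt \<epsilon>)"
    if \<epsilon>: "0 < \<epsilon>" for \<epsilon> :: real
  proof -
    obtain e where e: "(p + \<epsilon> *\<^sub>R 1) * e = 1" "e * (p + \<epsilon> *\<^sub>R 1) = 1"
      using cstar_positive_add_invertible[OF p \<epsilon>] by blast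
    have pe: "p * e = 1 - \<epsilon> *\<^sub>R e" and ep: "e * p = 1 - \<epsilon> *\<^sub>R e"
      using e by (simp_all add: distrib_left distrib_right eq_diff_eq)
    have pos: "cstar_positive e"
      using cstar_positive_inverse[OF cstar_positive_add[OF p cstar_positive_scaleR_one] e] \<epsilon> by simp
    have se: "selfadj e" by (rule cstar_positive_selfadj[OF pos])
    have "cstar_positive (1 - \<epsilon> *\<^sub>R e)"
      using cstar_positive_mult[OF p pos] pe ep by simp
    then have ne: "norm (\<epsilon> *\<^sub>R e) \<le> 1" "norm (e * p) \<le> 1"
      using cstar_positive_norm_mono[of "\<epsilon> *\<^sub>R e" 1] cstar_positive_norm_mono[of "1 - \<epsilon> *\<^sub>R e" 1]
        cstar_positive_scaleR[OF pos, of \<epsilon>] \<epsilon> ep by simp_all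
    \<comment> \<open>The decisive estimate: the inner square of this vector is \<epsilon> times a
      product of two elements of norm at most 1. Pairing with \<open>f\<close> then bounds
      \<open>x * (\<epsilon> e)\<close> by a multiple of \<open>sqrt \<epsilon>\<close>.\<close>
    have "norm (act (\<epsilon> *\<^sub>R e) \<psi>) \<le> sqrt \<epsilon>"
    proof (rule real_le_rsqrt)
      have "ip (act (\<epsilon> *\<^sub>R e) \<psi>) (act (\<epsilon> *\<^sub>R e) \<psi>) = \<epsilon> *\<^sub>R (\<epsilon> *\<^sub>R e * p * e)"
        by (simp add: ip_act_left ip_act_right involution_scaleR se p_def mult.assoc)
      also have "\<epsilon> *\<^sub>R e * p * e = (e * p) * (\<epsilon> *\<^sub>R e)" by simp
      finally have "(norm (act (\<epsilon> *\<^sub>R e) \<psi>))\<^sup>2 = \<epsilon> * norm ((e * p) * (\<epsilon> *\<^sub>R e))"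
        using \<epsilon> by (simp add: norm_sq)
      also have "\<dots> \<le> \<epsilon> * (norm (e * p) * norm (\<epsilon> *\<^sub>R e))"
        using \<epsilon> by (intro mult_left_mono norm_mult_ineq) auto
      also have "\<dots> \<le> \<epsilon> * (1 * 1)"
        using \<epsilon> ne by (intro mult_left_mono mult_mono) auto
      finally show "(norm (act (\<epsilon> *\<^sub>R e) \<psi>))\<^sup>2 \<le> \<epsilon>" by simp
    qed
    then have "norm (x * (\<epsilon> *\<^sub>R e)) \<le> 4 * norm f * sqrt \<epsilon>"
      using norm_ip_le[of f "act (\<epsilon> *\<^sub>R e) \<psi>"]
        mult_left_mono[of "norm (act (\<epsilon> *\<^sub>R e) \<psi>)" "sqrt \<epsilon>" "4 * norm f"]
      by (simp add: ip_act_right involution_scaleR se x_def)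
    moreover have "norm (ip \<psi> f) \<le> 4 * (norm f * norm \<psi>)" using norm_ip_le[of \<psi> f] by (simp add: mult_ac)
    ultimately have "norm (x * (\<epsilon> *\<^sub>R e) * ip \<psi> f) \<le> (4 * norm f * sqrt \<epsilon>) * (4 * (norm f * norm \<psi>))"
      by (meson mult_mono norm_ge_zero norm_mult_ineq order_trans)
    moreover have "x * ip \<psi> f - x * e * p * ip \<psi> f = x * (\<epsilon> *\<^sub>R e) * ip \<psi> f"
      by (simp add: mult.assoc[of x] ep right_diff_distrib left_diff_distrib)
    ultimately show ?thesis using conj_e[OF pos] ep pe by (intro exI[of _ "x * e * p * ip \<psi> f"]) (simp add: mult_ac)
  qed
  have "\<exists>a. \<forall>n. cstar_positive (a n) \<and> norm (x * ip \<psi> f - a n) \<le>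
      4 * (norm f * norm \<psi>) * (4 * norm f * sqrt (inverse (real (Suc n))))"
    by (intro choice allI approx) simp
  then obtain a where a: "\<And>n. cstar_positive (a n)" "\<And>n. norm (x * ip \<psi> f - a n) \<le>
      4 * (norm f * norm \<psi>) * (4 * norm f * sqrt (inverse (real (Suc n))))"
    by blast
  have "(\<lambda>n. 4 * (norm f * norm \<psi>) * (4 * norm f * sqrt (inverse (real (Suc n))))) \<longlonglongrightarrow>
      4 * (norm f * norm \<psi>) * (4 * norm f * sqrt 0)"
    by (intro tendsto_intros LIMSEQ_inverse_real_of_nat)
  then have "(\<lambda>n. 4 * (norm f * norm \<psi>) * (4 * norm f * sqrt (inverse (real (Suc n))))) \<longlonglongrightarrow> 0" by simp
  then have "(\<lambda>n. x * ip \<psi> f - a n) \<longlonglongrightarrow> 0"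
    by (rule Lim_null_comparison[rotated]) (intro always_eventually allI a(2))
  then have "a \<longlonglongrightarrow> x * ip \<psi> f"
    using tendsto_diff[OF tendsto_const[of "x * ip \<psi> f"], of "\<lambda>n. x * ip \<psi> f - a n" 0] by simp
  then have "x * ip \<psi> f \<in> {a. cstar_positive a}"
    by (rule Lim_in_closed_set[OF closed_cstar_positive, rotated -1]) (simp_all add: a(1))
  then show ?thesis by (simp add: x_def)
qed

end

lemma bounded_linear_pos_boundE:
  assumes "bounded_linear T"
  obtains K where "0 < K" "\<And>f. norm (T f) \<le> K * norm f"
  using bounded_linear.pos_bounded[OF assms] by (auto simp: mult.commute)

context hilbert_module
begin

section \<open>Self-adjoint operators\<close>

text \<open>The operator counterpart of \<open>selfadj_sqrt\<close>: the same iteration, run in the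
  Banach space of bounded operators with composition as product. Self-adjointness is a closed
  condition because \<open>ip\<close> is continuous.\<close>

lemma self_adjoint_sqrt:
  assumes R: "bounded_linear R" "self_adjoint_op ip R"
    and q: "q < 1" "\<And>f. norm (R f) \<le> q * norm f"
  obtains X where "self_adjoint_op ip X" "\<And>f. X (X f) = f - R f"
    "\<And>T f. bounded_linear T \<Longrightarrow> (\<And>f. T (R f) = R (T f)) \<Longrightarrow> T (X f) = X (T f)"
proof -
  define r where "r = Blinfun R"
  have r: "blinfun_apply r = R" by (simp add: r_def bounded_linear_Blinfun_apply R(1))
  have n: "norm r < 1"
  proof -
    \<comment> \<open>The given \<open>q\<close> may be negative, whereas an operator norm bound has
      to be nonnegative.\<close>
    have "norm (R f) \<le> max q 0 * norm f" for f
      using q(2)[of f] by (rule order_trans) (simp add: mult_right_mono)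
    then have "norm r \<le> max q 0" by (intro norm_blinfun_bound) (auto simp: r)
    then show ?thesis using q(1) by simp
  qed
  define V where "V = {y. (\<forall>f g. ip (blinfun_apply y f) g = ip f (blinfun_apply y g)) \<and>
    (\<forall>t. t o\<^sub>L r = r o\<^sub>L t \<longrightarrow> t o\<^sub>L y = y o\<^sub>L t)}"
  have V: "V = (\<Inter>f. \<Inter>g. {y::'h \<Rightarrow>\<^sub>L 'h. ip (blinfun_apply y f) g = ip f (blinfun_apply y g)}) \<inter>
      (\<Inter>t\<in>{t. t o\<^sub>L r = r o\<^sub>L t}. {y::'h \<Rightarrow>\<^sub>L 'h. t o\<^sub>L y = y o\<^sub>L t})"
    by (auto simp: V_def)
  have "closed V" unfolding V
    by (intro closed_Int closed_INT ballI closed_Collect_eq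
        bounded_bilinear.continuous_on[OF bounded_bilinear_ip]
        bounded_bilinear.continuous_on[OF bounded_bilinear_blinfun_compose]
        bounded_bilinear.continuous_on[OF bounded_bilinear_blinfun_apply]
        continuous_on_const continuous_on_id)
  moreover have "(1/2) *\<^sub>R (r + (y o\<^sub>L y)) \<in> V" if y: "y \<in> V" for y
  proof -
    have ya: "ip (y f) g = ip f (y g)" for f g using y by (simp add: V_def)
    have ra: "ip (R f) g = ip f (R g)" for f g using R(2) by (simp add: self_adjoint_op_def)
    have "t o\<^sub>L ((1/2) *\<^sub>R (r + (y o\<^sub>L y))) = ((1/2) *\<^sub>R (r + (y o\<^sub>L y))) o\<^sub>L t"
      if t: "t o\<^sub>L r = r o\<^sub>L t" for t
    proof (rule blinfun_eqI)
      fix f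
      have "t o\<^sub>L y = y o\<^sub>L t" using y t by (auto simp: V_def)
      then have ty: "t (y f) = y (t f)" for f by (metis blinfun_apply_blinfun_compose)
      have tr: "t (R f) = R (t f)" for f
        using arg_cong[OF t, of "\<lambda>s. blinfun_apply s f"] by (simp add: r)
      show "(t o\<^sub>L ((1/2) *\<^sub>R (r + (y o\<^sub>L y)))) f = (((1/2) *\<^sub>R (r + (y o\<^sub>L y))) o\<^sub>L t) f"
        by (simp add: r ty tr blinfun.add_left blinfun.add_right blinfun.scaleR_left blinfun.scaleR_right)
    qed
    moreover have "ip (blinfun_apply ((1/2) *\<^sub>R (r + (y o\<^sub>L y))) f) g =
        ip f (blinfun_apply ((1/2) *\<^sub>R (r + (y o\<^sub>L y))) g)" for f g
      by (simp add: r blinfun.add_left blinfun.scaleR_left ip_simps ya ra)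
    ultimately show ?thesis unfolding V_def by blast
  qed
  moreover have "0 \<in> V" by (simp add: V_def ip_simps 
      bounded_bilinear.zero_left[OF bounded_bilinear_blinfun_compose]
      bounded_bilinear.zero_right[OF bounded_bilinear_blinfun_compose])
  ultimately obtain y where y: "y \<in> V" "y = (1/2) *\<^sub>R (r + (y o\<^sub>L y))"
    using quadratic_fixpoint[OF bounded_bilinear_blinfun_compose norm_blinfun_compose n] by blast
  have yf: "R f = y f + y f - y (y f)" for f
  proof -
    have "2 *\<^sub>R y f = R f + y (y f)"
      by (subst y(2)) (simp add: r blinfun.add_left blinfun.scaleR_left)
    then show ?thesis by (simp add: scaleR_2 eq_diff_eq)
  qed
  show ?thesis
  proof
    have "ip (y f) g = ip f (y g)" for f g using y(1) by (simp add: V_def)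
    then show "self_adjoint_op ip (\<lambda>f. f - y f)" by (simp add: self_adjoint_op_def ip_simps)
    show "(f - y f) - y (f - y f) = f - R f" for f by (simp add: yf blinfun.diff_right)
    fix T f assume T: "bounded_linear T" "\<And>f. T (R f) = R (T f)"
    have t: "blinfun_apply (Blinfun T) = T" by (simp add: bounded_linear_Blinfun_apply T(1))
    have "Blinfun T o\<^sub>L r = r o\<^sub>L Blinfun T" by (rule blinfun_eqI) (simp add: t r T(2))
    then have "Blinfun T o\<^sub>L y = y o\<^sub>L Blinfun T" using y(1) by (simp add: V_def)
    then have "T (y f) = y (T f)" by (metis t blinfun_apply_blinfun_compose)
    then show "T (f - y f) = T f - y (T f)" by (simp add: linear_diff bounded_linear.linear T(1))
  qed
qed

text \<open>With \<open>k = K + \<epsilon>\<close> and \<open>X\<close> a root of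
  \<open>1 - T / k\<close>, the positive element \<open>k \<langle>X f, X f\<rangle>\<close> equals
  \<open>k \<langle>f, f\<rangle> - \<langle>T f, f\<rangle>\<close>.\<close>

lemma self_adjoint_le_bound:
  assumes T: "bounded_linear T" "self_adjoint_op ip T"
    and K: "0 \<le> K" "\<And>f. norm (T f) \<le> K * norm f"
  shows "cstar_positive (K *\<^sub>R ip f f - ip (T f) f)"
proof (rule cstar_positive_of_perturb)
  fix \<epsilon> :: real assume \<epsilon>: "0 < \<epsilon>"
  define k where "k = K + \<epsilon>"
  have k: "0 < k" using K(1) \<epsilon> by (simp add: k_def)
  obtain X where X: "self_adjoint_op ip X" "\<And>f. X (X f) = f - (1/k) *\<^sub>R T f"
  proof (rule self_adjoint_sqrt)
    show "bounded_linear (\<lambda>f. (1/k) *\<^sub>R T f)" by (rule bounded_linear_const_scaleR[OF T(1)])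
    show "self_adjoint_op ip (\<lambda>f. (1/k) *\<^sub>R T f)" using T(2) by (simp add: self_adjoint_op_def ip_simps)
    show "K / k < 1" using k \<epsilon> by (simp add: k_def)
    show "norm ((1/k) *\<^sub>R T f) \<le> K / k * norm f" for f
      using K(2)[of f] k by (simp add: divide_right_mono)
  qed blast
  have "cstar_positive (k *\<^sub>R ip (X f) (X f))"
    using k by (intro cstar_positive_scaleR ip_positive) simp
  also have "ip (X f) (X f) = ip (X (X f)) f" using X(1) by (simp add: self_adjoint_op_def)
  also have "k *\<^sub>R \<dots> = k *\<^sub>R ip f f - ip (T f) f" using k by (simp add: X(2) ip_simps scaleR_diff_right)
  also have "\<dots> = K *\<^sub>R ip f f - ip (T f) f + \<epsilon> *\<^sub>R ip f f" by (simp add: k_def scaleR_add_left)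
  finally show "cstar_positive (K *\<^sub>R ip f f - ip (T f) f + \<epsilon> *\<^sub>R ip f f)" .
qed

text \<open>Cauchy-Schwarz for the form \<open>\<langle>S f, g\<rangle>\<close> with \<open>g = S f\<close>; only a real multiple of \<open>g\<close> is
  subtracted from \<open>f\<close>, so that products of values of the form do not occur.\<close>

lemma positive_op_norm_square_le:
  assumes S: "self_adjoint_op ip S" "positive_op ip S"
    and q: "0 < q" "\<And>f. norm (ip (S f) f) \<le> q * (norm f)\<^sup>2"
  shows "(norm (S f))\<^sup>2 \<le> q * norm (ip (S f) f)"
proof -
  have sa: "ip (S f) g = ip f (S g)" for f g using S(1) by (simp add: self_adjoint_op_def)
  define x where "x = ip (S f) (S f)"
  define z where "z = ip (S (S f)) (S f)"
  define g where "g = f - (1/q) *\<^sub>R S f"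
  have "ip (S g) g = ip (S g) f - (1/q) *\<^sub>R ip (S g) (S f)" by (simp add: g_def ip_simps)
  also have "\<dots> = ip g (S f) - (1/q) *\<^sub>R ip g (S (S f))" by (simp only: sa)
  also have "\<dots> = ip (S f) f - (1/q) *\<^sub>R x - ((1/q) *\<^sub>R x - ((1/q) * (1/q)) *\<^sub>R z)"
  proof -
    have "ip f (S f) = ip (S f) f" "ip f (S (S f)) = x" "ip (S f) (S (S f)) = z"
      by (simp_all only: sa x_def z_def)
    then show ?thesis by (simp add: g_def ip_simps x_def[symmetric] scaleR_diff_right)
  qed
  also have "\<dots> = (ip (S f) f + ((1/q) * (1/q)) *\<^sub>R z) - (2/q) *\<^sub>R x"
  proof -
    have "(2/q) *\<^sub>R x = (1/q) *\<^sub>R x + (1/q) *\<^sub>R x" by (simp flip: scaleR_add_left)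
    then show ?thesis by simp
  qed
  finally have e: "ip (S g) g = (ip (S f) f + ((1/q) * (1/q)) *\<^sub>R z) - (2/q) *\<^sub>R x" .
  have "norm ((2/q) *\<^sub>R x) \<le> norm (ip (S f) f + ((1/q) * (1/q)) *\<^sub>R z)"
  proof (rule cstar_positive_norm_mono)
    show "cstar_positive ((2/q) *\<^sub>R x)"
      using q(1) by (intro cstar_positive_scaleR) (simp_all add: x_def ip_positive)
    show "cstar_positive ((ip (S f) f + ((1/q) * (1/q)) *\<^sub>R z) - (2/q) *\<^sub>R x)"
      unfolding e[symmetric] using S(2) by (simp add: positive_op_def)
  qed
  also have "\<dots> \<le> norm (ip (S f) f) + (1/q) * (1/q) * norm z"
    using q(1) norm_triangle_ineq[of "ip (S f) f" "((1/q) * (1/q)) *\<^sub>R z"] by simp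
  also have "\<dots> \<le> norm (ip (S f) f) + (1/q) * (1/q) * (q * (norm (S f))\<^sup>2)"
    using q unfolding z_def by (intro add_left_mono mult_left_mono) auto
  also have "\<dots> = norm (ip (S f) f) + (norm (S f))\<^sup>2 / q" using q(1) by simp
  finally have "2 * (norm (S f))\<^sup>2 / q \<le> norm (ip (S f) f) + (norm (S f))\<^sup>2 / q"
    using q(1) by (simp add: x_def flip: norm_sq)
  then have "(norm (S f))\<^sup>2 / q \<le> norm (ip (S f) f)" by simp
  then show ?thesis using q(1) by (simp add: divide_le_eq mult.commute)
qed

text \<open>Turns the order bounds \<open>0 \<le> S \<le> q\<close> into a norm bound, by inserting
  the bound of the form into the Cauchy-Schwarz estimate.\<close>

lemma positive_op_bound:
  assumes S: "self_adjoint_op ip S" "positive_op ip S"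
    and q: "0 < q" "\<And>f. cstar_positive (q *\<^sub>R ip f f - ip (S f) f)"
  shows "norm (S f) \<le> q * norm f"
proof -
  have le: "norm (ip (S f) f) \<le> q * (norm f)\<^sup>2" for f
    using cstar_positive_norm_mono[OF _ q(2)[of f]] S(2) q(1) by (simp add: positive_op_def norm_sq)
  have "(norm (S f))\<^sup>2 \<le> q * norm (ip (S f) f)"
    using positive_op_norm_square_le[OF S q(1) le] .
  also have "\<dots> \<le> q * (q * (norm f)\<^sup>2)" using q(1) by (intro mult_left_mono le) simp
  also have "\<dots> = (q * norm f)\<^sup>2" by (simp add: power2_eq_square)
  finally show ?thesis by (rule power2_le_imp_le) (use q(1) in simp)
qed

text \<open>A root \<open>X\<close> of \<open>(P + \<epsilon>) / k\<close> commutes with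
  \<open>Q\<close>, so \<open>k \<langle>Q X f, X f\<rangle>\<close> equals \<open>\<langle>P Q f,
  f\<rangle> + \<epsilon> \<langle>Q f, f\<rangle>\<close>.\<close>

lemma positive_op_compose:
  assumes P: "bounded_linear P" "self_adjoint_op ip P" "positive_op ip P"
    and Q: "bounded_linear Q" "positive_op ip Q" and PQ: "\<And>f. P (Q f) = Q (P f)"
  shows "positive_op ip (\<lambda>f. P (Q f))"
  unfolding positive_op_def
proof (rule allI, rule cstar_positive_of_perturb)
  fix f and \<epsilon> :: real assume \<epsilon>: "0 < \<epsilon>"
  obtain K where K: "0 < K" "\<And>f. norm (P f) \<le> K * norm f"
    using bounded_linear_pos_boundE[OF P(1)] by blast
  define k where "k = K + \<epsilon>"
  have k: "0 < k" using K(1) \<epsilon> by (simp add: k_def)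
  define S where "S f = K *\<^sub>R f - P f" for f
  have S: "bounded_linear S"
    unfolding S_def by (intro bounded_linear_sub bounded_linear_scaleR_right P(1))
  have Sa: "self_adjoint_op ip S" using P(2) by (simp add: self_adjoint_op_def S_def ip_simps)
  \<comment> \<open>The order bounds \<open>0 \<le> S \<le> K\<close> are essential here: the
    triangle inequality alone would give only \<open>2 * K\<close>, too large for the root.\<close>
  have nS: "norm (S f) \<le> K * norm f" for f
  proof (rule positive_op_bound[OF Sa])
    show "positive_op ip S"
      using self_adjoint_le_bound[OF P(1,2) less_imp_le[OF K(1)] K(2)]
      by (simp add: positive_op_def S_def ip_simps)
    show "cstar_positive (K *\<^sub>R ip f f - ip (S f) f)" for f
      using P(3) by (simp add: S_def ip_simps positive_op_def)
  qed (rule K(1))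
  obtain X where X: "self_adjoint_op ip X" "\<And>f. X (X f) = f - (1/k) *\<^sub>R S f"
    "\<And>T f. bounded_linear T \<Longrightarrow> (\<And>f. T ((1/k) *\<^sub>R S f) = (1/k) *\<^sub>R S (T f)) \<Longrightarrow> T (X f) = X (T f)"
  proof (rule self_adjoint_sqrt)
    show "bounded_linear (\<lambda>f. (1/k) *\<^sub>R S f)" by (rule bounded_linear_const_scaleR[OF S])
    show "self_adjoint_op ip (\<lambda>f. (1/k) *\<^sub>R S f)" using Sa by (simp add: self_adjoint_op_def ip_simps)
    show "K / k < 1" using k \<epsilon> by (simp add: k_def)
    show "norm ((1/k) *\<^sub>R S f) \<le> K / k * norm f" for f
      using nS[of f] k by (simp add: divide_right_mono)
  qed blast
  have QX: "Q (X f) = X (Q f)"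
    using bounded_linear.linear[OF Q(1)]
    by (intro X(3) Q(1)) (simp add: S_def linear_diff linear_scale PQ)
  have XX: "k *\<^sub>R X (X h) = P h + \<epsilon> *\<^sub>R h" for h
    using k by (simp add: X(2) S_def scaleR_diff_right) (simp add: k_def scaleR_add_left)
  have "cstar_positive (k *\<^sub>R ip (Q (X f)) (X f))"
    using k Q(2) by (intro cstar_positive_scaleR) (auto simp: positive_op_def)
  also have "ip (Q (X f)) (X f) = ip (X (X (Q f))) f" using X(1) by (simp add: QX self_adjoint_op_def)
  also have "k *\<^sub>R \<dots> = ip (k *\<^sub>R X (X (Q f))) f" by (simp add: ip_simps)
  also have "\<dots> = ip (P (Q f)) f + \<epsilon> *\<^sub>R ip (Q f) f" by (simp add: XX ip_simps)
  finally show "cstar_positive (ip (P (Q f)) f + \<epsilon> *\<^sub>R ip (Q f) f)" .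
qed

text \<open>For large \<open>k\<close> the operator \<open>P = 1 - D / k\<close> satisfies
  \<open>0 \<le> P \<le> 1 - m / k\<close>, so it is a contraction, and a fixed point of
  \<open>x \<mapsto> y / k + P x\<close> solves \<open>D x = y\<close>.\<close>

lemma surj_of_lower_bound:
  assumes D: "bounded_linear D" "self_adjoint_op ip D"
    and m: "0 < m" "\<And>f. cstar_positive (ip (D f) f - m *\<^sub>R ip f f)"
  shows "surj D"
  unfolding surj_def
proof
  fix y
  obtain K where K: "0 < K" "\<And>f. norm (D f) \<le> K * norm f"
    using bounded_linear_pos_boundE[OF D(1)] by blast
  \<comment> \<open>Adding \<open>m\<close> keeps \<open>k\<close> a norm bound of \<open>D\<close>
    and makes \<open>q = 1 - m / k\<close> strictly positive.\<close>
  define k where "k = K + m"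
  have k: "0 < k" "m < k" using K(1) m(1) by (auto simp: k_def)
  have Kk: "norm (D f) \<le> k * norm f" for f
    using K(2)[of f] m(1) by (simp add: k_def distrib_right add_increasing2)
  define q where "q = 1 - m / k"
  have q: "0 < q" "q < 1" using k m(1) by (auto simp: q_def)
  define P where "P f = f - (1/k) *\<^sub>R D f" for f
  have P: "bounded_linear P"
    unfolding P_def by (intro bounded_linear_sub bounded_linear_ident bounded_linear_const_scaleR D(1))
  have nP: "norm (P f) \<le> q * norm f" for f
  proof (rule positive_op_bound[OF _ _ q(1)])
    show "self_adjoint_op ip P" using D(2) by (simp add: self_adjoint_op_def P_def ip_simps)
    have "cstar_positive ((1/k) *\<^sub>R (k *\<^sub>R ip f f - ip (D f) f))" for f
      using k by (intro cstar_positive_scaleR self_adjoint_le_bound[OF D] Kk) auto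
    then show "positive_op ip P"
      using k by (simp add: positive_op_def P_def ip_simps scaleR_diff_right)
    have "cstar_positive ((1/k) *\<^sub>R (ip (D f) f - m *\<^sub>R ip f f))" for f
      using k by (intro cstar_positive_scaleR m(2)) auto
    then show "cstar_positive (q *\<^sub>R ip f f - ip (P f) f)" for f
      using k by (simp add: P_def q_def ip_simps scaleR_diff_right scaleR_diff_left)
  qed
  have "\<exists>!x. x \<in> UNIV \<and> (1/k) *\<^sub>R y + P x = x"
  proof (rule Banach_fix[where c = q])
    show "dist ((1/k) *\<^sub>R y + P x) ((1/k) *\<^sub>R y + P x') \<le> q * dist x x'" for x x'
      using nP[of "x - x'"] bounded_linear.linear[OF P] by (simp add: dist_norm linear_diff)
  qed (use q in \<open>auto simp: complete_UNIV\<close>)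
  then obtain x where "(1/k) *\<^sub>R y + P x = x" by auto
  then have "(1/k) *\<^sub>R y = (1/k) *\<^sub>R D x" by (simp add: P_def eq_diff_eq algebra_simps)
  then show "\<exists>x. y = D x" using k by auto
qed

end

section \<open>Unordered sums\<close>

text \<open>The Cauchy criterion, stated with finite sets disjoint from \<open>F0\<close> so that
  two families can be compared sum by sum.\<close>

lemma summable_on_Cauchy:
  fixes f :: "'i \<Rightarrow> 'b::banach"
  shows "f summable_on J \<longleftrightarrow> (\<forall>e>0. \<exists>F0. finite F0 \<and> F0 \<subseteq> J \<and>
    (\<forall>F. finite F \<and> F \<subseteq> J \<and> F \<inter> F0 = {} \<longrightarrow> norm (sum f F) < e))" (is "_ \<longleftrightarrow> ?R")
proof
  assume "f summable_on J"
  then obtain S where S: "(sum f \<longlongrightarrow> S) (finite_subsets_at_top J)"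
    by (auto simp: summable_on_def has_sum_def)
  show ?R
  proof (intro allI impI)
    fix e :: real assume "e > 0"
    then have "\<forall>\<^sub>F F in finite_subsets_at_top J. dist (sum f F) S < e / 2"
      using S by (intro tendstoD) auto
    then obtain F0 where F0: "finite F0" "F0 \<subseteq> J"
        "\<And>F. finite F \<Longrightarrow> F0 \<subseteq> F \<Longrightarrow> F \<subseteq> J \<Longrightarrow> dist (sum f F) S < e / 2"
      by (auto simp: eventually_finite_subsets_at_top)
    have "norm (sum f F) < e" if F: "finite F" "F \<subseteq> J" "F \<inter> F0 = {}" for F
    proof -
      have "sum f F = sum f (F0 \<union> F) - sum f F0"
        using F F0 by (subst sum.union_disjoint) auto
      then have "norm (sum f F) = dist (sum f (F0 \<union> F)) (sum f F0)" by (simp add: dist_norm)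
      also have "\<dots> \<le> dist (sum f (F0 \<union> F)) S + dist (sum f F0) S" by (rule dist_triangle2)
      also have "\<dots> < e / 2 + e / 2" using F F0(1,2) by (intro add_strict_mono F0(3)) auto
      finally show ?thesis by simp
    qed
    then show "\<exists>F0. finite F0 \<and> F0 \<subseteq> J \<and>
        (\<forall>F. finite F \<and> F \<subseteq> J \<and> F \<inter> F0 = {} \<longrightarrow> norm (sum f F) < e)"
      using F0 by blast
  qed
next
  assume R: ?R
  have "\<exists>P. eventually P (finite_subsets_at_top J) \<and>
      (\<forall>F1 F2. P F1 \<and> P F2 \<longrightarrow> dist (sum f F1) (sum f F2) < e)" if "e > 0" for e
  proof -
    obtain F0 where F0: "finite F0" "F0 \<subseteq> J"
        "\<And>F. finite F \<Longrightarrow> F \<subseteq> J \<Longrightarrow> F \<inter> F0 = {} \<Longrightarrow> norm (sum f F) < e / 2"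
      using R \<open>e > 0\<close> by (meson half_gt_zero)
    define P where "P F = (finite F \<and> F0 \<subseteq> F \<and> F \<subseteq> J)" for F
    have "eventually P (finite_subsets_at_top J)"
      unfolding P_def eventually_finite_subsets_at_top using F0 by blast
    moreover have d: "dist (sum f F) (sum f F0) < e / 2" if "P F" for F
    proof -
      have "sum f F - sum f F0 = sum f (F - F0)" using that F0 by (simp add: P_def sum_diff)
      then show ?thesis using that F0(3)[of "F - F0"] by (auto simp: dist_norm P_def)
    qed
    have "dist (sum f F1) (sum f F2) < e" if "P F1" "P F2" for F1 F2
      using d[OF that(1)] d[OF that(2)] dist_triangle2[of "sum f F1" "sum f F2" "sum f F0"] by simp
    ultimately show ?thesis by blast
  qed
  then have "cauchy_filter (filtermap (sum f) (finite_subsets_at_top J))"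
    by (simp add: cauchy_filter_metric_filtermap)
  moreover have "complete (UNIV::'b set)" by (rule complete_UNIV)
  ultimately obtain L where "(sum f \<longlongrightarrow> L) (finite_subsets_at_top J)"
    using complete_uniform[where S=UNIV] by (force simp add: filterlim_def)
  then show "f summable_on J" by (auto simp: summable_on_def has_sum_def)
qed

text \<open>Designed for the frame operator, whose partial sums satisfy a quadratic estimate by
  partial sums of the form.\<close>

lemma summable_on_comparison_square:
  fixes f :: "'i \<Rightarrow> 'b::banach" and g :: "'i \<Rightarrow> 'c::banach"
  assumes g: "g summable_on J" and K: "0 < K"
    and le: "\<And>F. finite F \<Longrightarrow> F \<subseteq> J \<Longrightarrow> (norm (sum f F))\<^sup>2 \<le> K * norm (sum g F)"
  shows "f summable_on J"
  unfolding summable_on_Cauchy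
proof (intro allI impI)
  fix e :: real assume e: "e > 0"
  then have "e\<^sup>2 / K > 0" using K by simp
  then obtain F0 where F0: "finite F0" "F0 \<subseteq> J"
      "\<And>F. finite F \<Longrightarrow> F \<subseteq> J \<Longrightarrow> F \<inter> F0 = {} \<Longrightarrow> norm (sum g F) < e\<^sup>2 / K"
    using g unfolding summable_on_Cauchy by meson
  have "norm (sum f F) < e" if F: "finite F" "F \<subseteq> J" "F \<inter> F0 = {}" for F
  proof (rule power2_less_imp_less)
    have "K * norm (sum g F) < e\<^sup>2" using F0(3)[OF F] K by (simp add: less_divide_eq mult.commute)
    then show "(norm (sum f F))\<^sup>2 < e\<^sup>2" using le[OF F(1,2)] by simp
  qed (use e in simp)
  then show "\<exists>F0. finite F0 \<and> F0 \<subseteq> J \<and>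
      (\<forall>F. finite F \<and> F \<subseteq> J \<and> F \<inter> F0 = {} \<longrightarrow> norm (sum f F) < e)"
    using F0 by blast
qed

lemma cstar_positive_infsum:
  fixes f :: "'i \<Rightarrow> 'a::unital_cstar_algebra"
  assumes "\<And>j. j \<in> J \<Longrightarrow> cstar_positive (f j)"
  shows "cstar_positive (infsum f J)"
proof (cases "f summable_on J")
  case True
  then have "(sum f \<longlongrightarrow> infsum f J) (finite_subsets_at_top J)"
    using has_sum_infsum has_sum_def by blast
  moreover have "\<forall>\<^sub>F F in finite_subsets_at_top J. sum f F \<in> {a. cstar_positive a}"
    by (rule eventually_finite_subsets_at_top_weakI) (auto intro!: cstar_positive_sum assms)
  ultimately have "infsum f J \<in> {a. cstar_positive a}"
    by (intro Lim_in_closed_set[OF closed_cstar_positive]) auto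
  then show ?thesis by simp
\<comment> \<open>Without summability \<open>infsum\<close> is 0, which is positive as well.\<close>
qed (simp add: infsum_not_exists)

text \<open>The sum over the remaining indices is positive, so monotonicity of the norm
  applies.\<close>

lemma norm_sum_le_infsum_positive:
  fixes f :: "'i \<Rightarrow> 'a::unital_cstar_algebra"
  assumes pos: "\<And>j. j \<in> J \<Longrightarrow> cstar_positive (f j)" and f: "f summable_on J"
    and F: "finite F" "F \<subseteq> J"
  shows "norm (sum f F) \<le> norm (infsum f J)"
proof (rule cstar_positive_norm_mono)
  show "cstar_positive (sum f F)" using pos F by (intro cstar_positive_sum) auto
  have "infsum f J - sum f F = infsum f (J - F)"
    using infsum_Diff[OF f _ F(2)] F by simp
  then show "cstar_positive (infsum f J - sum f F)"
    using pos by (auto intro!: cstar_positive_infsum)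
qed

lemma sesquilinear_diagonal_summable:
  fixes B :: "'i \<Rightarrow> 'h::complex_banach \<Rightarrow> 'h \<Rightarrow> 'a::complex_banach"
  assumes B: "\<And>j. sesquilinear (B j)" and s: "\<And>f. (\<lambda>j. B j f f) summable_on J"
  shows "(\<lambda>j. B j f g) summable_on J"
proof -
  have "(\<lambda>j. (1/4) *\<^sub>R (B j (f + g) (f + g) - B j (f - g) (f - g) +
      (\<i> *\<^sub>C B j (f + \<i> *\<^sub>C g) (f + \<i> *\<^sub>C g) - \<i> *\<^sub>C B j (f - \<i> *\<^sub>C g) (f - \<i> *\<^sub>C g)))) summable_on J"
    unfolding diff_conv_add_uminus
    by (intro summable_on_bounded_linear[OF bounded_linear_scaleR_right]
        summable_on_bounded_linear[OF bounded_linear_scaleC] summable_on_add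
        summable_on_uminus[THEN iffD2] s)
  then show ?thesis by (simp flip: polarization[OF B])
qed

lemma sesquilinear_infsum:
  fixes B :: "'i \<Rightarrow> 'h::complex_banach \<Rightarrow> 'h \<Rightarrow> 'a::complex_banach"
  assumes B: "\<And>j. sesquilinear (B j)" and s: "\<And>f g. (\<lambda>j. B j f g) summable_on J"
  shows "sesquilinear (\<lambda>f g. \<Sum>\<^sub>\<infinity>j\<in>J. B j f g)"
proof -
  have "(\<Sum>\<^sub>\<infinity>j\<in>J. c *\<^sub>C B j f g) = c *\<^sub>C (\<Sum>\<^sub>\<infinity>j\<in>J. B j f g)" for c f g
    by (intro infsumI has_sum_bounded_linear[OF bounded_linear_scaleC] has_sum_infsum s)
  then show ?thesis
    by (simp add: sesquilinear_def sesquilinear_simps[OF B] infsum_add s)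
qed

lemma sesquilinear_eqI:
  assumes "sesquilinear B" "sesquilinear B'" "\<And>f. B f f = B' f f"
  shows "B f g = B' f g"
  by (simp only: polarization[OF assms(1), of f g] polarization[OF assms(2), of f g] assms(3))

section \<open>The frame operator of a Bessel family\<close>

context hilbert_module
begin

lemma sesquilinear_op: "bounded_clinear T \<Longrightarrow> sesquilinear (\<lambda>f g. ip (T f) g)"
  by (simp add: sesquilinear_def bounded_clinearD ip_simps)

lemma sesquilinear_op_right: "bounded_clinear T \<Longrightarrow> sesquilinear (\<lambda>f g. ip f (T g))"
  by (simp add: sesquilinear_def bounded_clinearD ip_simps)

lemma sesquilinear_ip_mult_ip: "sesquilinear (\<lambda>f g. ip f \<psi> * ip \<phi> g)"
  by (simp add: sesquilinear_def ip_simps distrib_left distrib_right mult_scaleC_left mult_scaleC_right)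

text \<open>Linearity follows by moving \<open>T\<close> to the other argument, since
  \<open>ip\<close> separates points; for the frame operator no manipulation of sums is then
  required.\<close>

lemma self_adjoint_bounded_clinear:
  assumes T: "self_adjoint_op ip T" and K: "\<And>f. norm (T f) \<le> K * norm f"
  shows "bounded_clinear T"
proof -
  have sa: "ip (T f) g = ip f (T g)" for f g using T by (simp add: self_adjoint_op_def)
  have "T (f + g) = T f + T g" for f g by (rule ip_eqI) (simp add: sa ip_simps)
  moreover have c: "T (c *\<^sub>C f) = c *\<^sub>C T f" for c f by (rule ip_eqI) (simp add: sa ip_simps)
  moreover have "T (r *\<^sub>R f) = r *\<^sub>R T f" for r f
    using c[of "complex_of_real r"] by (simp add: scaleC_of_real)
  ultimately show ?thesis
    using K unfolding bounded_clinear_def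
    by (intro conjI bounded_linear_intro[where K = K]) (simp_all add: mult.commute)
qed

lemma ip_sum_left: "ip (\<Sum>j\<in>F. f j) g = (\<Sum>j\<in>F. ip (f j) g)"
  by (rule bounded_bilinear.sum_left[OF bounded_bilinear_ip])

context
  fixes J :: "'i set" and \<psi> :: "'i \<Rightarrow> 'h" and K :: real
  assumes bessel_summable: "\<And>f. (\<lambda>j. ip f (\<psi> j) * ip (\<psi> j) f) summable_on J"
    and bessel_bound: "\<And>f. norm (\<Sum>\<^sub>\<infinity>j\<in>J. ip f (\<psi> j) * ip (\<psi> j) f) \<le> K * (norm f)\<^sup>2"
    and bessel_pos: "0 < K"
begin

text \<open>Every finite partial sum is a positive self-adjoint operator whose form is bounded by
  \<open>K\<close>, so \<open>positive_op_norm_square_le\<close> supplies the quadratic comparison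
  with the Bessel sum.\<close>

lemma frame_operator_summable: "(\<lambda>j. act (ip f (\<psi> j)) (\<psi> j)) summable_on J"
proof (rule summable_on_comparison_square[OF bessel_summable[of f] bessel_pos])
  fix F assume F: "finite F" "F \<subseteq> J"
  define T where "T f = (\<Sum>j\<in>F. act (ip f (\<psi> j)) (\<psi> j))" for f
  have T: "ip (T f) g = (\<Sum>j\<in>F. ip f (\<psi> j) * ip (\<psi> j) g)" for f g
    by (simp add: T_def ip_sum_left ip_act_left)
  have "ip f (T g) = involution (ip (T g) f)" for f g by (simp add: ip_involution)
  also have "\<dots> f g = (\<Sum>j\<in>F. involution (ip g (\<psi> j) * ip (\<psi> j) f))" for f g
    using F by (simp add: T linear_sum[OF bounded_linear.linear[OF bounded_linear_involution]])
  finally have "self_adjoint_op ip T" by (simp add: self_adjoint_op_def T involution_mult ip_involution)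
  moreover have "positive_op ip T"
    by (simp add: positive_op_def T cstar_positive_sum ip_mult_ip_positive)
  moreover have "norm (ip (T f) f) \<le> K * (norm f)\<^sup>2" for f
    unfolding T using norm_sum_le_infsum_positive[OF _ bessel_summable F] bessel_bound
    by (meson ip_mult_ip_positive order_trans)
  ultimately have "(norm (T f))\<^sup>2 \<le> K * norm (ip (T f) f)"
    by (rule positive_op_norm_square_le[OF _ _ bessel_pos])
  then show "(norm (\<Sum>j\<in>F. act (ip f (\<psi> j)) (\<psi> j)))\<^sup>2 \<le>
      K * norm (\<Sum>j\<in>F. ip f (\<psi> j) * ip (\<psi> j) f)"
    by (simp only: T T_def[symmetric])
qed

lemma frame_operator_has_sum:
  "((\<lambda>j. ip f (\<psi> j) * ip (\<psi> j) g) has_sum ip (frame_operator act ip J \<psi> f) g) J"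
  using has_sum_bounded_linear[OF bounded_bilinear.bounded_linear_left[OF bounded_bilinear_ip]
      has_sum_infsum[OF frame_operator_summable[of f]], of g]
  by (simp add: ip_act_left frame_operator_def)

lemma frame_operator_self_adjoint: "self_adjoint_op ip (frame_operator act ip J \<psi>)"
  unfolding self_adjoint_op_def
proof (intro allI)
  fix f g
  have "((\<lambda>j. ip f (\<psi> j) * ip (\<psi> j) g) has_sum ip f (frame_operator act ip J \<psi> g)) J"
    using has_sum_bounded_linear[OF bounded_linear_involution frame_operator_has_sum[of g f]]
    by (simp add: involution_mult ip_involution)
  then show "ip (frame_operator act ip J \<psi> f) g = ip f (frame_operator act ip J \<psi> g)"
    using frame_operator_has_sum has_sum_unique by blast
qed

lemma ip_frame_operator: "ip (frame_operator act ip J \<psi> f) g = (\<Sum>\<^sub>\<infinity>j\<in>J. ip f (\<psi> j) * ip (\<psi> j) g)"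
  by (rule infsumI[OF frame_operator_has_sum, symmetric])

lemma frame_operator_positive: "positive_op ip (frame_operator act ip J \<psi>)"
  by (simp add: positive_op_def ip_frame_operator cstar_positive_infsum ip_mult_ip_positive)

lemma frame_operator_bounded: "bounded_clinear (frame_operator act ip J \<psi>)"
proof (rule self_adjoint_bounded_clinear[OF frame_operator_self_adjoint])
  fix f
  let ?S = "frame_operator act ip J \<psi>"
  have b: "norm (ip (?S f) f) \<le> K * (norm f)\<^sup>2" for f by (simp add: ip_frame_operator bessel_bound)
  have "(norm (?S f))\<^sup>2 \<le> K * norm (ip (?S f) f)"
    by (rule positive_op_norm_square_le[OF frame_operator_self_adjoint frame_operator_positive bessel_pos b])
  also have "\<dots> \<le> K * (K * (norm f)\<^sup>2)" using bessel_pos by (intro mult_left_mono b) simp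
  also have "\<dots> = (K * norm f)\<^sup>2" by (simp add: power2_eq_square)
  finally show "norm (?S f) \<le> K * norm f" by (rule power2_le_imp_le) (use bessel_pos in simp)
qed

end

section \<open>Controlled frames\<close>

lemma controlled_frame_bessel:
  assumes C: "C \<in> GL" "self_adjoint_op ip C" and cf: "controlled_frame ip C J \<psi>"
  obtains K where "0 < K" "\<And>f. (\<lambda>j. ip f (\<psi> j) * ip (\<psi> j) f) summable_on J"
    "\<And>f. norm (\<Sum>\<^sub>\<infinity>j\<in>J. ip f (\<psi> j) * ip (\<psi> j) f) \<le> K * (norm f)\<^sup>2"
proof -
  define b where "b j f g = ip f (\<psi> j) * ip (C (\<psi> j)) g" for j f g
  define B where "B f g = (\<Sum>\<^sub>\<infinity>j\<in>J. b j f g)" for f g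
  have b: "sesquilinear (b j)" for j unfolding b_def by (rule sesquilinear_ip_mult_ip)
  obtain m M where m: "m > 0" and s: "\<And>f. (\<lambda>j. b j f f) summable_on J"
    and lo: "\<And>f. cstar_positive (B f f - m *\<^sub>R ip f f)"
    and up: "\<And>f. cstar_positive (M *\<^sub>R ip f f - B f f)"
    using cf unfolding controlled_frame_def cstar_le_def b_def B_def by blast
  have s2: "(\<lambda>j. b j f g) summable_on J" for f g by (rule sesquilinear_diagonal_summable[OF b s])
  have B: "sesquilinear B" unfolding B_def by (rule sesquilinear_infsum[OF b s2])
  \<comment> \<open>The absolute value appears because the definition leaves the sign of
    \<open>M\<close> open.\<close>
  have "norm (B f f) \<le> \<bar>M\<bar> * (norm f)\<^sup>2" for f
  proof -
    have "cstar_positive (B f f)"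
      using cstar_positive_add[OF lo[of f] cstar_positive_scaleR[OF ip_positive[of f], of m]] m by simp
    then show ?thesis using cstar_positive_norm_mono[OF _ up[of f]] by (simp add: norm_sq)
  qed
  then have nB: "norm (B f g) \<le> 4 * \<bar>M\<bar> * norm f * norm g" for f g by (rule sesquilinear_bound[OF B])
  obtain C' where C': "bounded_clinear C'" "\<And>f. C (C' f) = f"
    using C(1) by (auto simp: GL_def fun_eq_iff)
  obtain k where k: "0 < k" "\<And>f. norm (C' f) \<le> k * norm f"
    using bounded_linear_pos_boundE[OF bounded_clinearD(1)[OF C'(1)]] by blast
  \<comment> \<open>Self-adjointness moves \<open>C\<close> onto \<open>C' f\<close>, where it
    cancels; the Bessel terms are thus off-diagonal values of the controlled form.\<close>
  have e: "ip f (\<psi> j) * ip (\<psi> j) f = b j f (C' f)" for f j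
    using C(2) by (simp add: b_def self_adjoint_op_def C'(2))
  \<comment> \<open>The summand 1 keeps the constant strictly positive even if \<open>M\<close> is
    0.\<close>
  show ?thesis
  proof (rule that[of "4 * \<bar>M\<bar> * k + 1"])
    show "0 < 4 * \<bar>M\<bar> * k + 1" using k by (simp add: add_nonneg_pos)
    fix f
    show "(\<lambda>j. ip f (\<psi> j) * ip (\<psi> j) f) summable_on J" unfolding e by (rule s2)
    have "norm (B f (C' f)) \<le> 4 * \<bar>M\<bar> * norm f * norm (C' f)" by (rule nB)
    also have "\<dots> \<le> 4 * \<bar>M\<bar> * norm f * (k * norm f)" by (intro mult_left_mono k) simp
    also have "\<dots> = (4 * \<bar>M\<bar> * k) * (norm f)\<^sup>2" by (simp add: power2_eq_square)
    also have "\<dots> \<le> (4 * \<bar>M\<bar> * k + 1) * (norm f)\<^sup>2" by (intro mult_right_mono) auto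
    finally show "norm (\<Sum>\<^sub>\<infinity>j\<in>J. ip f (\<psi> j) * ip (\<psi> j) f) \<le> (4 * \<bar>M\<bar> * k + 1) * (norm f)\<^sup>2"
      unfolding e B_def .
  qed
qed

lemma frame_bessel:
  assumes "frame ip J \<psi>"
  obtains K where "0 < K" "\<And>f. (\<lambda>j. ip f (\<psi> j) * ip (\<psi> j) f) summable_on J"
    "\<And>f. norm (\<Sum>\<^sub>\<infinity>j\<in>J. ip f (\<psi> j) * ip (\<psi> j) f) \<le> K * (norm f)\<^sup>2"
proof -
  obtain \<beta> where \<beta>: "0 < \<beta>" "\<And>f. (\<lambda>j. ip f (\<psi> j) * ip (\<psi> j) f) summable_on J"
    "\<And>f. cstar_positive (\<beta> *\<^sub>R ip f f - (\<Sum>\<^sub>\<infinity>j\<in>J. ip f (\<psi> j) * ip (\<psi> j) f))"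
    using assms unfolding frame_def cstar_le_def by blast
  have "norm (\<Sum>\<^sub>\<infinity>j\<in>J. ip f (\<psi> j) * ip (\<psi> j) f) \<le> \<beta> * (norm f)\<^sup>2" for f
    using cstar_positive_norm_mono[OF cstar_positive_infsum \<beta>(3)[of f]] \<beta>(1)
    by (simp add: norm_sq ip_mult_ip_positive)
  with \<beta> that show ?thesis by blast
qed

lemma self_adjoint_compose:
  assumes "self_adjoint_op ip S" "self_adjoint_op ip T" "\<And>f. S (T f) = T (S f)"
  shows "self_adjoint_op ip (\<lambda>f. S (T f))"
  using assms by (simp add: self_adjoint_op_def)

lemma controlled_frame_imp_frame:
  assumes C: "C \<in> GL" "self_adjoint_op ip C" and cf: "controlled_frame ip C J \<psi>"
  shows "frame ip J \<psi>" "positive_op ip C"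
    "C \<circ> frame_operator act ip J \<psi> = frame_operator act ip J \<psi> \<circ> C"
proof -
  obtain K where K: "0 < K" "\<And>f. (\<lambda>j. ip f (\<psi> j) * ip (\<psi> j) f) summable_on J"
    "\<And>f. norm (\<Sum>\<^sub>\<infinity>j\<in>J. ip f (\<psi> j) * ip (\<psi> j) f) \<le> K * (norm f)\<^sup>2"
    using controlled_frame_bessel[OF C cf] by blast
  note bessel = K(2,3,1)
  define S where "S = frame_operator act ip J \<psi>"
  have S: "self_adjoint_op ip S" "positive_op ip S" "bounded_clinear S"
    unfolding S_def
    by (rule frame_operator_self_adjoint[OF bessel] frame_operator_positive[OF bessel]
        frame_operator_bounded[OF bessel])+
  have ipS: "(\<Sum>\<^sub>\<infinity>j\<in>J. ip f (\<psi> j) * ip (\<psi> j) g) = ip (S f) g" for f g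
    unfolding S_def by (rule ip_frame_operator[OF bessel, symmetric])
  have Cc: "bounded_clinear C" using C(1) by (simp add: GL_def)
  obtain C' where C': "\<And>f. C' (C f) = f" using C(1) by (auto simp: GL_def fun_eq_iff)
  have sC: "ip (C f) g = ip f (C g)" for f g using C(2) by (simp add: self_adjoint_op_def)
  have sS: "ip (S f) g = ip f (S g)" for f g using S(1) by (simp add: self_adjoint_op_def)
  define D where "D f = C (S f)" for f
  have ipD: "(\<Sum>\<^sub>\<infinity>j\<in>J. ip f (\<psi> j) * ip (C (\<psi> j)) g) = ip (D f) g" for f g
    by (simp add: D_def sC ipS)
  obtain m M where m: "m > 0" and lo: "\<And>f. cstar_positive (ip (D f) f - m *\<^sub>R ip f f)"
    using cf unfolding controlled_frame_def cstar_le_def ipD by blast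
  have D: "bounded_clinear D" unfolding D_def by (rule bounded_clinear_compose[OF Cc S(3)])
  have posD: "cstar_positive (ip (D f) f)" for f
    using cstar_positive_add[OF lo[of f] cstar_positive_scaleR[OF ip_positive[of f], of m]] m by simp
  \<comment> \<open>Positive elements are self-adjoint, so the two forms agree on the diagonal,
    hence everywhere by polarization.\<close>
  have sD: "ip (D f) g = ip f (D g)" for f g
  proof (rule sesquilinear_eqI[OF sesquilinear_op[OF D] sesquilinear_op_right[OF D]])
    show "ip (D f) f = ip f (D f)" for f
      using cstar_positive_selfadj[OF posD[of f]] by (simp add: ip_involution)
  qed
  \<comment> \<open>Self-adjointness of \<open>D = C S\<close> says that \<open>C S\<close> equals
    its adjoint, which is \<open>S C\<close>.\<close>
  have comm: "C (S f) = S (C f)" for f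
    by (rule ip_eqI) (metis D_def sC sD sS)
  then show "C \<circ> frame_operator act ip J \<psi> = frame_operator act ip J \<psi> \<circ> C"
    by (simp add: fun_eq_iff flip: S_def)
  have Da: "self_adjoint_op ip D" by (simp add: self_adjoint_op_def sD)
  have DS: "positive_op ip (\<lambda>f. D (S f))"
  proof (rule positive_op_compose[of D S])
    show "positive_op ip D" by (simp add: positive_op_def posD)
    show "D (S f) = S (D f)" for f by (simp add: D_def comm)
  qed (use D Da S in \<open>simp_all add: bounded_clinearD(1)\<close>)
  show "positive_op ip C"
    unfolding positive_op_def
  proof
    fix f
    \<comment> \<open>Surjectivity of \<open>D\<close> is applied to \<open>C f\<close>, and
      cancelling the injective \<open>C\<close> gives \<open>f = S g\<close>.\<close>
    obtain g where "C f = D g"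
      using surjD[OF surj_of_lower_bound[OF bounded_clinearD(1)[OF D] Da m lo], of "C f"] by blast
    then have f: "f = S g" unfolding D_def by (metis C')
    have "ip (C f) f = ip (D (S g)) g" unfolding f by (simp add: sS D_def comm)
    then show "cstar_positive (ip (C f) f)" using DS by (simp add: positive_op_def)
  qed
  obtain k where k: "0 < k" "\<And>f. norm (C f) \<le> k * norm f"
    using bounded_linear_pos_boundE[OF bounded_clinearD(1)[OF Cc]] by blast
  obtain \<beta> where \<beta>: "0 < \<beta>" "\<And>f. norm (S f) \<le> \<beta> * norm f"
    using bounded_linear_pos_boundE[OF bounded_clinearD(1)[OF S(3)]] by blast
  define P where "P f = k *\<^sub>R f - C f" for f
  have PS: "positive_op ip (\<lambda>f. P (S f))"
  proof (rule positive_op_compose[of P S])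
    show "bounded_linear P"
      unfolding P_def by (intro bounded_linear_sub bounded_linear_scaleR_right bounded_clinearD(1)[OF Cc])
    show "self_adjoint_op ip P" by (simp add: self_adjoint_op_def P_def ip_simps sC)
    show "positive_op ip P"
      using self_adjoint_le_bound[OF bounded_clinearD(1)[OF Cc] C(2) less_imp_le[OF k(1)] k(2)]
      by (simp add: positive_op_def P_def ip_simps)
    show "P (S f) = S (P f)" for f by (simp add: P_def comm bounded_clinearD[OF S(3)])
  qed (use S in \<open>simp_all add: bounded_clinearD(1)\<close>)
  have "cstar_positive (ip (S f) f - (m / k) *\<^sub>R ip f f)" for f
  proof -
    \<comment> \<open>The operator identity behind this is
      \<open>(k - C) S + (C S - m) = k S - m\<close>.\<close>
    have "cstar_positive ((1/k) *\<^sub>R (ip (P (S f)) f + (ip (D f) f - m *\<^sub>R ip f f)))"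
      using PS k(1) by (intro cstar_positive_scaleR cstar_positive_add lo) (auto simp: positive_op_def)
    also have "(1/k) *\<^sub>R (ip (P (S f)) f + (ip (D f) f - m *\<^sub>R ip f f)) = ip (S f) f - (m / k) *\<^sub>R ip f f"
      using k(1) by (simp add: P_def D_def ip_simps scaleR_diff_right)
    finally show ?thesis .
  qed
  moreover have "cstar_positive (\<beta> *\<^sub>R ip f f - ip (S f) f)" for f
    using \<beta> by (intro self_adjoint_le_bound bounded_clinearD(1) S) auto
  moreover have "m / k > 0" using m k by simp
  ultimately show "frame ip J \<psi>"
    unfolding frame_def cstar_le_def ipS using \<beta>(1) K(2) by blast
qed

lemma frame_imp_controlled_frame:
  assumes C: "C \<in> GL" "self_adjoint_op ip C" and fr: "frame ip J \<psi>" and pC: "positive_op ip C"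
    and CS: "C \<circ> frame_operator act ip J \<psi> = frame_operator act ip J \<psi> \<circ> C"
  shows "controlled_frame ip C J \<psi>"
proof -
  obtain K where K: "0 < K" "\<And>f. (\<lambda>j. ip f (\<psi> j) * ip (\<psi> j) f) summable_on J"
    "\<And>f. norm (\<Sum>\<^sub>\<infinity>j\<in>J. ip f (\<psi> j) * ip (\<psi> j) f) \<le> K * (norm f)\<^sup>2"
    using frame_bessel[OF fr] by blast
  note bessel = K(2,3,1)
  define S where "S = frame_operator act ip J \<psi>"
  have S: "self_adjoint_op ip S" "bounded_clinear S"
    unfolding S_def
    by (rule frame_operator_self_adjoint[OF bessel] frame_operator_bounded[OF bessel])+
  have comm: "C (S f) = S (C f)" for f using CS unfolding S_def by (metis comp_apply)
  obtain \<alpha> where \<alpha>: "0 < \<alpha>" "\<And>f. cstar_positive (ip (S f) f - \<alpha> *\<^sub>R ip f f)"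
    using fr unfolding frame_def cstar_le_def S_def ip_frame_operator[OF bessel] by blast
  have Cc: "bounded_clinear C" using C(1) by (simp add: GL_def)
  obtain C' where C': "bounded_clinear C'" "\<And>f. C' (C f) = f" "\<And>f. C (C' f) = f"
    using C(1) by (auto simp: GL_def fun_eq_iff)
  have sC: "ip (C f) g = ip f (C g)" for f g using C(2) by (simp add: self_adjoint_op_def)
  have sC': "ip (C' f) g = ip f (C' g)" for f g by (metis C'(3) sC)
  obtain k where k: "0 < k" "\<And>f. norm (C' f) \<le> k * norm f"
    using bounded_linear_pos_boundE[OF bounded_clinearD(1)[OF C'(1)]] by blast
  define D where "D f = C (S f)" for f
  have D: "bounded_clinear D" unfolding D_def by (rule bounded_clinear_compose[OF Cc S(2)])
  have Da: "self_adjoint_op ip D"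
    unfolding D_def by (rule self_adjoint_compose[OF C(2) S(1) comm])
  obtain M where M: "0 < M" "\<And>f. norm (D f) \<le> M * norm f"
    using bounded_linear_pos_boundE[OF bounded_clinearD(1)[OF D]] by blast
  \<comment> \<open>The weak form of the frame operator is evaluated at \<open>C f\<close>, and
    \<open>C\<close> is moved across both inner products.\<close>
  have sumD: "((\<lambda>j. ip f (\<psi> j) * ip (C (\<psi> j)) f) has_sum ip (D f) f) J" for f
    using frame_operator_has_sum[OF bessel, of f "C f"] by (simp add: sC D_def S_def)
  define P where "P f = k *\<^sub>R f - C' f" for f
  have PC: "positive_op ip (\<lambda>f. P (C f))"
  proof (rule positive_op_compose[of P C])
    show P: "bounded_linear P"
      unfolding P_def
      by (intro bounded_linear_sub bounded_linear_scaleR_right bounded_clinearD(1)[OF C'(1)])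
    show "self_adjoint_op ip P" by (simp add: self_adjoint_op_def P_def ip_simps sC')
    show "positive_op ip P"
      using self_adjoint_le_bound[OF bounded_clinearD(1)[OF C'(1)] _ less_imp_le[OF k(1)] k(2)]
      by (simp add: positive_op_def P_def ip_simps self_adjoint_op_def sC')
    show "P (C f) = C (P f)" for f by (simp add: P_def C' bounded_clinearD[OF Cc])
  qed (use Cc pC in \<open>simp_all add: bounded_clinearD(1)\<close>)
  define Q where "Q f = S f - \<alpha> *\<^sub>R f" for f
  have CQ: "positive_op ip (\<lambda>f. C (Q f))"
  proof (rule positive_op_compose[of C Q])
    show "bounded_linear Q"
      unfolding Q_def by (intro bounded_linear_sub bounded_linear_scaleR_right bounded_clinearD(1)[OF S(2)])
    show "positive_op ip Q" using \<alpha>(2) by (simp add: positive_op_def Q_def ip_simps)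
    show "C (Q f) = Q (C f)" for f by (simp add: Q_def comm bounded_clinearD[OF Cc])
  qed (use Cc C pC in \<open>simp_all add: bounded_clinearD(1)\<close>)
  have "cstar_positive (ip (D f) f - (\<alpha> / k) *\<^sub>R ip f f)" for f
  proof -
    \<comment> \<open>Since \<open>C' C = 1\<close>, the operators satisfy \<open>C (S - \<alpha>) +
      (\<alpha> / k) (k - C') C = C S - \<alpha> / k\<close>.\<close>
    have "cstar_positive (ip (C (Q f)) f + (\<alpha> / k) *\<^sub>R ip (P (C f)) f)"
      using CQ PC k(1) \<alpha>(1)
      by (intro cstar_positive_scaleR cstar_positive_add) (auto simp: positive_op_def)
    also have "ip (C (Q f)) f + (\<alpha> / k) *\<^sub>R ip (P (C f)) f = ip (D f) f - (\<alpha> / k) *\<^sub>R ip f f"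
      using k(1)
      by (simp add: P_def Q_def D_def C' ip_simps scaleR_diff_right bounded_clinearD[OF Cc])
    finally show ?thesis .
  qed
  moreover have "cstar_positive (M *\<^sub>R ip f f - ip (D f) f)" for f
    using M by (intro self_adjoint_le_bound bounded_clinearD(1) D Da) auto
  moreover have "\<alpha> / k > 0" using \<alpha>(1) k(1) by simp
  moreover have "(\<lambda>j. ip f (\<psi> j) * ip (C (\<psi> j)) f) summable_on J" for f
    using sumD by (auto simp: summable_on_def)
  moreover have "(\<Sum>\<^sub>\<infinity>j\<in>J. ip f (\<psi> j) * ip (C (\<psi> j)) f) = ip (D f) f" for f
    using sumD by (rule infsumI)
  ultimately show ?thesis unfolding controlled_frame_def cstar_le_def by auto
qed

end

theorem proposition3p11:
  fixes act :: "'a::unital_cstar_algebra \<Rightarrow> 'h::complex_banach \<Rightarrow> 'h"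
    and ip :: "'h \<Rightarrow> 'h \<Rightarrow> 'a"
    and C :: "'h \<Rightarrow> 'h"
    and J :: "'i set"
    and \<psi> :: "'i \<Rightarrow> 'h"
  assumes "hilbert_module act ip"
    and "finitely_generated act \<or> countably_generated act"
    and "C \<in> GL"
    and "self_adjoint_op ip C"
    and "countable J"
  shows "controlled_frame ip C J \<psi> \<longleftrightarrow>
    frame ip J \<psi> \<and> positive_op ip C \<and>
    C \<circ> frame_operator act ip J \<psi> = frame_operator act ip J \<psi> \<circ> C"
proof -
  interpret hilbert_module act ip by (rule assms(1))
  show ?thesis
    using controlled_frame_imp_frame[OF assms(3,4)] frame_imp_controlled_frame[OF assms(3,4)]
    by metis
qed

end
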